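(* Let $V$ be a vector space of dimension $2k$ over the finite field $\mathbb{F}_q$ of order $q$, where $k\ge 1$, and let $m$ be a positive integer such that $m\le k$. (i) Let $k_1\le k_2$ be non-negative integers with $k_1+k_2\le m$. If $k_2>m/2$, then the subspace-bisection geometry $\mathrm{Proj}_{(m,k)}^{(k_1,k_2)}(V)$ is concurrently complete if and only if $(q,k)=(2,1)$. (ii) $\mathrm{Proj}_{(m,k)}^{(0,0)}(V)$ is concurrently complete if and only if $(q,k)\ne (2,1),(3,1),(2,2)$.
   Context: A bisection of a $2k$-dimensional vector space $V$ is an unordered pair $\{V_1,V_2\}$ of subspaces with $V=V_1\oplus V_2$ and $\dim V_1=\dim V_2=k$. The subspace-bisection geometry $\mathrm{Proj}_{(m,k)}^{(k_1,k_2)}(V)$ has as points all $m$-dimensional subspaces of $V$, as lines all bisections of $V$, and a point $U$ is incident with a line $\{V_1,V_2\}$ if and only if $(\dim(U\cap V_1),\dim(U\cap V_2))$ equals $(k_1,k_2)$ or $(k_2,k_1)$. A point/line geometry is concurrently complete if each pair of distinct lines is incident with at least one common point.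
   Formalization: In (ii) the case (q,k,m)=(2,2,1) is counted as concurrently complete: in F_2^4 two bisections cover at most 12 of the 15 nonzero vectors, so an uncovered vector spans a common point and the claim as worded fails there; all other (q,k,m) are as stated. *)

theory Defs
  imports Complex_Main "HOL-Library.Cardinality"
begin

record ('p, 'l) geometry =
  points :: "'p set"
  lines :: "'l set"
  incident :: "'p \<Rightarrow> 'l \<Rightarrow> bool"

definition concurrently_complete :: "('p, 'l) geometry \<Rightarrow> bool" where
  "concurrently_complete G \<longleftrightarrow>
     (\<forall>l\<in>lines G. \<forall>l'\<in>lines G. l \<noteq> l' \<longrightarrow>
        (\<exists>p\<in>points G. incident G p l \<and> incident G p l'))"

(* Below, the vector space V is the whole type 'v, with scalar multiplication s; all definitions are
   meant for s satisfying the locale vector_space. The library value of dim is 0 on spaces that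
   are not finitely generated, so an assumption of the form dim UNIV = n with n > 0 includes
   finite-dimensionality. The definitions stay outside the locale because the global interpretation
   for real vector spaces would shadow the names of its constants. *)

definition internal_direct_sum ::
    "('f::field \<Rightarrow> 'v::ab_group_add \<Rightarrow> 'v) \<Rightarrow> 'v set \<Rightarrow> 'v set \<Rightarrow> bool" where
  "internal_direct_sum s V1 V2 \<longleftrightarrow>
     module.subspace s V1 \<and> module.subspace s V2 \<and>
     {x + y | x y. x \<in> V1 \<and> y \<in> V2} = UNIV \<and> V1 \<inter> V2 = {0}"

definition bisections ::
    "('f::field \<Rightarrow> 'v::ab_group_add \<Rightarrow> 'v) \<Rightarrow> nat \<Rightarrow> 'v set set set" where
  "bisections s k =
     {{V1, V2} | V1 V2. internal_direct_sum s V1 V2 \<and>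
        vector_space.dim s V1 = k \<and> vector_space.dim s V2 = k}"

(* Bisections are unordered pairs; as the incidence condition is symmetric under swapping k1 and k2,
   it does not depend on how l is written as {V1, V2}. *)
definition subspace_bisection_geometry ::
    "('f::field \<Rightarrow> 'v::ab_group_add \<Rightarrow> 'v) \<Rightarrow> nat \<Rightarrow> nat \<Rightarrow> nat \<Rightarrow> nat \<Rightarrow>
       ('v set, 'v set set) geometry" where
  "subspace_bisection_geometry s m k k1 k2 =
     \<lparr> points = {U. module.subspace s U \<and> vector_space.dim s U = m},
       lines = bisections s k,
       incident = (\<lambda>U l. \<exists>V1 V2. l = {V1, V2} \<and>
         (vector_space.dim s (U \<inter> V1), vector_space.dim s (U \<inter> V2)) \<in> {(k1, k2), (k2, k1)}) \<rparr>"

end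

theory Submission
  imports Defs
begin

text \<open>
  For (ii) one needs a common complement U of the four k-dimensional subspaces V1, V2, W1, W2. If u
  lies outside all four and H is a hyperplane containing u but not the components of u in V1 and in W1
  (hence in none of the four), then intersecting with H and factoring out u turns the two
  bisections into bisections of the (2k-2)-dimensional space H/u, and a common complement there lifts
  to one of the original subspaces. Counting provides u as soon as the order of the field satisfies
  q^k \<ge> 4, so the induction on k can start at k = 0 for q \<ge> 4, at k = 2 for q = 3, and at k = 3 for
  q = 2. The last two base cases use that u and H can be
  chosen such that the reduced bisections are in special position: a shared component, or one
  component meeting both components of the other bisection.

  For (i), let W1 be a common complement of V1 and V2, and W2 one of V1, V2 and W1. Then the four
  subspaces intersect trivially in pairs, and a point U incident with both {V1, V2} and {W1, W2} would
  contain two subspaces of dimension k2 > m/2 with trivial intersection.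

  In the exceptional cases of (ii), four subspaces forming two bisections cover a subspace S with
  dim S + m > 2k, which every m-dimensional subspace meets non-trivially.
\<close>

section \<open>Subspaces over a finite field\<close>

text \<open>The obstacle is that common complements can fail to exist in dimension two for q = 2, 3
  and in dimension four for q = 2, so for these fields a quotient by an arbitrary u may lead into a
  bad case. The reduction therefore has a parameter: a subspace K through u that the hyperplane has
  to contain. Vectors of K survive in the quotient, so meetings of components can be preserved; and
  if u = a + b with a and b in components of different bisections, then a = -b modulo u, so meetings
  can also be created. The price is that the components of u have to stay outside K, and most of the
  case work consists in choosing u accordingly. How much coincidence is needed is decided in the
  plane, which has q + 1 lines: for q = 3 one coincidence among the four lines suffices, for q = 2
  two are needed. Over two elements in dimension four, the position where one component meets both
  components of the other bisection gets a direct construction instead of a reduction.\<close>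

locale finite_field_space = vector_space scale
  for scale :: "'f::{field,finite} \<Rightarrow> 'v::ab_group_add \<Rightarrow> 'v" (infixr "*s" 75)
begin

lemma card_field_ge_2: "2 \<le> CARD('f)"
proof -
  have "card {0, 1 :: 'f} \<le> CARD('f)" by (rule card_mono) auto
  then show ?thesis by simp
qed

lemma mem_span_insert:
  assumes "subspace A"
  shows "x \<in> span (insert u A) \<longleftrightarrow> (\<exists>c. x - c *s u \<in> A)"
  using assms by (simp add: span_insert span_eq_iff[THEN iffD2])

lemma span_insert_span: "span (insert u (span S)) = span (insert u S)"
  by (simp only: span_insert span_span)

lemma span_insertI: "subspace A \<Longrightarrow> x - c *s u \<in> A \<Longrightarrow> x \<in> span (insert u A)"
  using mem_span_insert by blast

lemma span_insertE:
  assumes "x \<in> span (insert u A)" "subspace A"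
  obtains c where "x - c *s u \<in> A"
  using assms mem_span_insert by blast

lemma span_insert_superset: "A \<subseteq> span (insert u A)"
  by (meson span_superset subset_insertI subset_trans)

lemma span_insert_mem: "u \<in> span (insert u A)"
  by (simp add: span_base)

lemma span_insert_least: "subspace L \<Longrightarrow> A \<subseteq> L \<Longrightarrow> u \<in> L \<Longrightarrow> span (insert u A) \<subseteq> L"
  by (simp add: span_minimal)

lemma mem_of_scale_mem:
  assumes "subspace A" "c *s x \<in> A" "c \<noteq> 0"
  shows "x \<in> A"
  using subspace_scale[OF assms(1,2), of "inverse c"] assms(3) by simp

lemma card_span_insert:
  assumes "subspace A" "u \<notin> A"
  shows "card (span (insert u A)) = CARD('f) * card A"
proof -
  have "bij_betw (\<lambda>(c, a). c *s u + a) (UNIV \<times> A) (span (insert u A))"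
  proof (rule bij_betwI')
    fix x y assume "x \<in> (UNIV :: 'f set) \<times> A" "y \<in> (UNIV :: 'f set) \<times> A"
    moreover obtain c a d b where [simp]: "x = (c, a)" "y = (d, b)" by force
    ultimately have ab: "a \<in> A" "b \<in> A" by auto
    show "((case x of (c, a) \<Rightarrow> c *s u + a) = (case y of (c, a) \<Rightarrow> c *s u + a)) = (x = y)"
    proof
      assume "(case x of (c, a) \<Rightarrow> c *s u + a) = (case y of (c, a) \<Rightarrow> c *s u + a)"
      then have "(c - d) *s u = b - a" by (simp add: scale_left_diff_distrib algebra_simps)
      then have "c - d = 0"
        using mem_of_scale_mem[OF assms(1)] subspace_diff[OF assms(1) ab(2,1)] assms(2) by metis
      then show "x = y" using \<open>(c - d) *s u = b - a\<close> by simp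
    qed auto
  next
    fix x assume "x \<in> (UNIV :: 'f set) \<times> A"
    then obtain c a where "x = (c, a)" "a \<in> A" by blast
    then show "(case x of (c, a) \<Rightarrow> c *s u + a) \<in> span (insert u A)"
      using mem_span_insert[OF assms(1)] by (simp add: exI[of _ c])
  next
    fix y assume "y \<in> span (insert u A)"
    then obtain c where "y - c *s u \<in> A" using mem_span_insert[OF assms(1)] by blast
    then show "\<exists>x\<in>UNIV \<times> A. y = (case x of (c, a) \<Rightarrow> c *s u + a)"
      by (intro bexI[of _ "(c, y - c *s u)"]) auto
  qed
  then have "card ((UNIV :: 'f set) \<times> A) = card (span (insert u A))"
    by (rule bij_betw_same_card)
  then show ?thesis by (simp add: card_cartesian_product)
qed

lemma card_span_independent:
  assumes "finite B" "independent B"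
  shows "card (span B) = CARD('f) ^ card B"
  using assms
proof (induction B)
  case (insert b B)
  then have "b \<notin> span B" "independent B" by (auto simp: independent_insert)
  have "card (span (insert b B)) = CARD('f) * card (span B)"
    using card_span_insert[OF subspace_span \<open>b \<notin> span B\<close>] by (simp only: span_insert_span)
  then show ?case using insert.IH[OF \<open>independent B\<close>] insert.hyps by simp
qed simp

text \<open>Trivial intersection makes addition injective on \<open>A \<times> B\<close>. If the
  cardinalities agree, the map is onto the finite set \<open>D\<close>, which yields decompositions
  without a choice of bases.\<close>

lemma card_direct_sum_le:
  assumes "subspace A" "subspace B" "subspace D" "A \<subseteq> D" "B \<subseteq> D" "A \<inter> B = {0}" "finite D"
  shows "card A * card B \<le> card D"
    and "card A * card B = card D \<Longrightarrow> x \<in> D \<Longrightarrow> \<exists>a\<in>A. \<exists>b\<in>B. x = a + b"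
proof -
  let ?f = "\<lambda>(a, b). a + b"
  have inj: "inj_on ?f (A \<times> B)"
  proof (rule inj_onI, clarify)
    fix a b a' b' assume *: "a \<in> A" "b \<in> B" "a' \<in> A" "b' \<in> B" "a + b = a' + b'"
    then have "a - a' = b' - b" by (simp add: algebra_simps)
    moreover have "a - a' \<in> A" "b' - b \<in> B" using * subspace_diff[OF assms(1)] subspace_diff[OF assms(2)] by simp_all
    ultimately have "a - a' \<in> A \<inter> B" by simp
    then have "a - a' = 0" using assms(6) by blast
    then show "a = a' \<and> b = b'" using * by simp
  qed
  have im: "?f ` (A \<times> B) \<subseteq> D"
    using subspace_add[OF assms(3)] assms(4,5) by (auto dest: subsetD)
  have card: "card (?f ` (A \<times> B)) = card A * card B"
    using card_image[OF inj] by (simp add: card_cartesian_product)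
  show "card A * card B \<le> card D" using card_mono[OF assms(7) im] card by simp
  assume "card A * card B = card D" "x \<in> D"
  then have "?f ` (A \<times> B) = D" using card_subset_eq[OF assms(7) im] card by simp
  then obtain z where "z \<in> A \<times> B" "x = ?f z" using \<open>x \<in> D\<close> by blast
  then show "\<exists>a\<in>A. \<exists>b\<in>B. x = a + b" by (auto split: prod.splits)
qed

text \<open>If one vector misses only \<open>A\<close> and another misses only \<open>B\<close>,
  their sum misses both.\<close>

lemma not_union_two_proper:
  assumes "subspace L" "subspace A" "subspace B" "\<not> L \<subseteq> A" "\<not> L \<subseteq> B"
  obtains x where "x \<in> L" "x \<notin> A" "x \<notin> B"
proof -
  obtain x y where xy: "x \<in> L" "x \<notin> A" "y \<in> L" "y \<notin> B" using assms(4,5) by blast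
  consider "x \<notin> B" | "y \<notin> A" | "x \<in> B" "y \<in> A" by blast
  then show ?thesis
  proof cases
    case 3
    have "x + y \<in> L" using xy assms(1) subspace_add by blast
    moreover have "x + y \<notin> A" using 3 xy subspace_diff[OF assms(2), of "x + y" y] by auto
    moreover have "x + y \<notin> B" using 3 xy subspace_diff[OF assms(3), of "x + y" x] by auto
    ultimately show ?thesis by (rule that)
  qed (use xy in \<open>auto intro: that\<close>)
qed

text \<open>The sum of the four cardinalities counts \<open>Z\<close> four times, the union only
  once; this is the gain of \<open>3 * card Z\<close>. Where fewer than four sets have to be
  avoided, \<open>{0}\<close> fills the remaining places.\<close>

lemma not_union_four:
  assumes "card A + card B + card C + card D < card L + 3 * card Z"
    and "finite A" "finite B" "finite C" "finite D"
    and "Z \<subseteq> A" "Z \<subseteq> B" "Z \<subseteq> C" "Z \<subseteq> D"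
  obtains x where "x \<in> L" "x \<notin> A" "x \<notin> B" "x \<notin> C" "x \<notin> D"
proof -
  have "finite Z" using assms(2,6) finite_subset by blast
  have "A \<union> B \<union> C \<union> D = A \<union> (B - Z) \<union> (C - Z) \<union> (D - Z)" using assms(6) by blast
  also have "card \<dots> \<le> card A + card (B - Z) + card (C - Z) + card (D - Z)"
    by (meson add_le_mono card_Un_le le_refl le_trans)
  also have "\<dots> < card L"
    using assms(1) \<open>finite Z\<close> card_mono[OF assms(3) assms(7)] card_mono[OF assms(4) assms(8)]
      card_mono[OF assms(5) assms(9)] assms(7-9) by (simp add: card_Diff_subset)
  finally have "\<not> L \<subseteq> A \<union> B \<union> C \<union> D"
    using assms(2-5) card_mono[of "A \<union> B \<union> C \<union> D" L] by auto
  then obtain x where "x \<in> L" "x \<notin> A \<union> B \<union> C \<union> D" by blast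
  then show ?thesis by (intro that) auto
qed

text \<open>A subspace between \<open>K\<close> and \<open>L\<close> that is maximal among those
  avoiding \<open>v\<close> and \<open>w\<close> is a hyperplane. If some \<open>x\<close> of
  \<open>L\<close> lay outside both \<open>span (insert v H)\<close> and
  \<open>span (insert w H)\<close>, adjoining it to \<open>H\<close> would bring in neither
  \<open>v\<close> nor \<open>w\<close>, against maximality. So these two spans cover
  \<open>L\<close>, and one of them is \<open>L\<close>.\<close>

lemma hyperplane_avoiding:
  assumes "subspace K" "subspace L" "K \<subseteq> L" "finite L" "v \<in> L" "w \<in> L" "v \<notin> K" "w \<notin> K"
  obtains H where "subspace H" "K \<subseteq> H" "H \<subseteq> L" "v \<notin> H" "w \<notin> H" "card L = CARD('f) * card H"
    "\<And>x. x \<in> L \<Longrightarrow> x \<notin> H \<Longrightarrow> L = span (insert x H)"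
proof -
  let ?S = "{H. subspace H \<and> K \<subseteq> H \<and> H \<subseteq> L \<and> v \<notin> H \<and> w \<notin> H}"
  have "finite ?S" by (rule finite_subset[of _ "Pow L"]) (use assms in auto)
  moreover have "?S \<noteq> {}" using assms by blast
  ultimately obtain H where "H \<in> ?S" and max: "\<forall>H'\<in>?S. H \<subseteq> H' \<longrightarrow> H = H'"
    using finite_has_maximal[of ?S] by blast
  then have H: "subspace H" "K \<subseteq> H" "H \<subseteq> L" "v \<notin> H" "w \<notin> H" by auto
  have "L \<subseteq> span (insert v H) \<or> L \<subseteq> span (insert w H)"
  proof (rule ccontr)
    assume "\<not> ?thesis"
    then obtain x where x: "x \<in> L" "x \<notin> span (insert v H)" "x \<notin> span (insert w H)"
      using not_union_two_proper[OF assms(2) subspace_span subspace_span] by metis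
    \<comment> \<open>Exchange: if adjoining \<open>x\<close> brought in \<open>z\<close>, then
      adjoining \<open>z\<close> would bring in \<open>x\<close>.\<close>
    have notin: "z \<notin> span (insert x H)" if "z \<notin> H" "x \<notin> span (insert z H)" for z
    proof
      assume "z \<in> span (insert x H)"
      then obtain c where c: "z - c *s x \<in> H" using mem_span_insert[OF H(1)] by blast
      then have "c \<noteq> 0" using that by auto
      have "(- inverse c) *s (z - c *s x) \<in> H" using c H(1) subspace_scale by blast
      then have "x - inverse c *s z \<in> H" using \<open>c \<noteq> 0\<close> by (simp add: scale_right_diff_distrib)
      then show False using that mem_span_insert[OF H(1)] by blast
    qed
    have "span (insert x H) \<in> ?S"
      using notin[of v] notin[of w] H x span_insert_superset[of H x]
        span_insert_least[OF assms(2) H(3) x(1)] by auto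
    then have "H = span (insert x H)" using max span_insert_superset by blast
    then have "x \<in> H" using span_insert_mem by blast
    then show False using x span_insert_superset by blast
  qed
  then have card: "card L = CARD('f) * card H"
    using card_span_insert[OF H(1,4)] card_span_insert[OF H(1,5)]
      span_insert_least[OF assms(2) H(3) assms(5)] span_insert_least[OF assms(2) H(3) assms(6)]
    by (metis subset_antisym)
  have "L = span (insert x H)" if "x \<in> L" "x \<notin> H" for x
    using card_subset_eq[OF assms(4) span_insert_least[OF assms(2) H(3) that(1)]]
      card card_span_insert[OF H(1) that(2)] by simp
  then show ?thesis by (rule that[OF H card])
qed

text \<open>Dimensions are expressed by cardinalities, and the ambient space \<open>L\<close> is a
  parameter because the induction passes to subspaces representing subquotients. That
  \<open>A\<close> and \<open>B\<close> together span \<open>L\<close> follows from the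
  cardinalities, see \<open>bisec_decomp\<close>.\<close>

definition bisec :: "nat \<Rightarrow> 'v set \<Rightarrow> 'v set \<Rightarrow> 'v set \<Rightarrow> bool" where
  "bisec k L A B \<longleftrightarrow> subspace L \<and> subspace A \<and> subspace B \<and> A \<subseteq> L \<and> B \<subseteq> L \<and> A \<inter> B = {0} \<and>
     card L = CARD('f) ^ (2 * k) \<and> card A = CARD('f) ^ k \<and> card B = CARD('f) ^ k"

text \<open>For components of bisections of \<open>L\<close>, the cardinality of \<open>U\<close>
  turns trivial intersection into being a complement.\<close>

definition common_compl :: "nat \<Rightarrow> 'v set \<Rightarrow> 'v set set \<Rightarrow> bool" where
  "common_compl k L S \<longleftrightarrow>
     (\<exists>U. subspace U \<and> U \<subseteq> L \<and> card U = CARD('f) ^ k \<and> (\<forall>A\<in>S. U \<inter> A = {0}))"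

lemma bisecD:
  assumes "bisec k L A B"
  shows "subspace L" "subspace A" "subspace B" "A \<subseteq> L" "B \<subseteq> L" "A \<inter> B = {0}"
    "card L = CARD('f) ^ (2 * k)" "card A = CARD('f) ^ k" "card B = CARD('f) ^ k"
    "finite L" "finite A" "finite B" "0 \<in> L" "0 \<in> A" "0 \<in> B"
proof -
  show *: "subspace L" "subspace A" "subspace B" "A \<subseteq> L" "B \<subseteq> L" "A \<inter> B = {0}"
    "card L = CARD('f) ^ (2 * k)" "card A = CARD('f) ^ k" "card B = CARD('f) ^ k"
    using assms by (simp_all add: bisec_def)
  show "finite L" using *(7) by (intro card_ge_0_finite) simp
  then show "finite A" "finite B" using *(4,5) finite_subset by metis+
  show "0 \<in> L" "0 \<in> A" "0 \<in> B" using subspace_0 *(1-3) by metis+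
qed

lemma bisec_commute: "bisec k L A B \<Longrightarrow> bisec k L B A"
  by (simp add: bisec_def Int_commute)

lemma bisec_decomp:
  assumes "bisec k L A B" "x \<in> L"
  obtains a where "a \<in> A" "x - a \<in> B"
proof -
  note D = bisecD[OF assms(1)]
  have "card A * card B = card L" using D(7-9) by (simp add: power_add[symmetric] mult_2)
  then obtain a b where "a \<in> A" "b \<in> B" "x = a + b"
    using card_direct_sum_le(2)[OF D(2,3,1,4,5,6,10) _ assms(2)] by blast
  then show ?thesis by (intro that) auto
qed

lemma bisec_disjoint: "bisec k L A B \<Longrightarrow> x \<in> A \<Longrightarrow> x \<in> B \<Longrightarrow> x = 0"
  unfolding bisec_def by blast

section \<open>Passing to a subquotient of codimension two\<close>

text \<open>With H = span (insert u C) and C representing the quotient H/u, this is the image of A \<inter> H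
  in H/u.\<close>

definition red :: "'v \<Rightarrow> 'v set \<Rightarrow> 'v set \<Rightarrow> 'v set" where
  "red u C A = {x \<in> C. \<exists>c. x + c *s u \<in> A}"

lemma red_subset: "red u C A \<subseteq> C"
  by (simp add: red_def)

lemma subspace_red:
  assumes "subspace C" "subspace A"
  shows "subspace (red u C A)"
proof (rule subspaceI)
  show "0 \<in> red u C A"
    using subspace_0[OF assms(1)] subspace_0[OF assms(2)] by (auto simp: red_def intro: exI[of _ 0])
next
  fix x y assume "x \<in> red u C A" "y \<in> red u C A"
  then obtain c d where "x \<in> C" "y \<in> C" "x + c *s u \<in> A" "y + d *s u \<in> A"
    by (auto simp: red_def)
  then have "x + y \<in> C" "(x + c *s u) + (y + d *s u) \<in> A"
    using subspace_add[OF assms(1)] subspace_add[OF assms(2)] by auto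
  moreover have "(x + c *s u) + (y + d *s u) = (x + y) + (c + d) *s u"
    by (simp add: scale_left_distrib)
  ultimately show "x + y \<in> red u C A" unfolding red_def by auto
next
  fix c x assume "x \<in> red u C A"
  then obtain d where "x \<in> C" "x + d *s u \<in> A" by (auto simp: red_def)
  then have "c *s x \<in> C" "c *s (x + d *s u) \<in> A"
    using subspace_scale[OF assms(1)] subspace_scale[OF assms(2)] by auto
  moreover have "c *s (x + d *s u) = c *s x + (c * d) *s u" by (simp add: scale_right_distrib)
  ultimately show "c *s x \<in> red u C A" unfolding red_def by auto
qed

text \<open>Both sides are the preimage in \<open>H\<close> of the image of
  \<open>A \<inter> H\<close> in H/u.\<close>

lemma span_insert_red:
  assumes "subspace A" "subspace C" "H = span (insert u C)"
  shows "span (insert u (A \<inter> H)) = span (insert u (red u C A))"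
proof -
  have H: "subspace H" using assms(3) by simp
  have u: "u \<in> H" and C: "C \<subseteq> H" using assms(3) span_insert_mem span_insert_superset by auto
  have R: "subspace (red u C A)" using subspace_red assms by blast
  have "x \<in> span (insert u (red u C A))" if "x \<in> A \<inter> H" for x
  proof -
    obtain c where "x - c *s u \<in> C" using mem_span_insert[OF assms(2)] assms(3) \<open>x \<in> A \<inter> H\<close> by auto
    then have "x - c *s u \<in> red u C A"
      using \<open>x \<in> A \<inter> H\<close> by (auto simp: red_def intro!: exI[of _ c])
    then show ?thesis by (rule span_insertI[OF R])
  qed
  then have "span (insert u (A \<inter> H)) \<subseteq> span (insert u (red u C A))"
    using span_insert_mem by (intro span_insert_least subspace_span subsetI)
  moreover have "x \<in> span (insert u (A \<inter> H))" if "x \<in> red u C A" for x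
  proof -
    obtain c where c: "x \<in> C" "x + c *s u \<in> A" using \<open>x \<in> red u C A\<close> by (auto simp: red_def)
    then have "x + c *s u \<in> A \<inter> H" using C u H subspace_add[OF H] subspace_scale[OF H] by auto
    then have "x - (- c) *s u \<in> A \<inter> H" by simp
    then show ?thesis by (rule span_insertI[OF subspace_inter[OF assms(1) H]])
  qed
  then have "span (insert u (red u C A)) \<subseteq> span (insert u (A \<inter> H))"
    using span_insert_mem by (intro span_insert_least subspace_span subsetI)
  ultimately show ?thesis by (rule subset_antisym)
qed

text \<open>The vector \<open>a\<close> shows that \<open>A \<inter> H\<close> has index q in
  \<open>A\<close>, and \<open>u \<notin> A\<close> makes the projection of
  \<open>A \<inter> H\<close> to H/u injective.\<close>

lemma card_red:
  assumes "subspace A" "A \<subseteq> L" "subspace C" "H = span (insert u C)" "u \<notin> C" "u \<notin> A"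
    and "a \<in> A" "a \<notin> H" "L = span (insert a H)"
  shows "card A = CARD('f) * card (red u C A)"
proof -
  have H: "subspace H" using assms(4) by simp
  have AH: "subspace (A \<inter> H)" using subspace_inter[OF assms(1) H] .
  have R: "subspace (red u C A)" using subspace_red assms(1,3) by blast
  have "x \<in> span (insert a (A \<inter> H))" if "x \<in> A" for x
  proof -
    have "x \<in> span (insert a H)" using assms(2,9) that by blast
    then obtain c where "x - c *s a \<in> H" using H by (rule span_insertE)
    moreover have "x - c *s a \<in> A"
      using subspace_diff[OF assms(1) that subspace_scale[OF assms(1,7)]] .
    ultimately show ?thesis by (intro span_insertI[OF AH]) simp
  qed
  then have "A = span (insert a (A \<inter> H))"
    using span_insert_least[OF assms(1) _ assms(7), of "A \<inter> H"] by auto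
  then have "card A = CARD('f) * card (A \<inter> H)" using card_span_insert[OF AH, of a] assms(8) by auto
  moreover have "CARD('f) * card (A \<inter> H) = CARD('f) * card (red u C A)"
    using card_span_insert[OF AH, of u] card_span_insert[OF R, of u] assms(5,6)
      span_insert_red[OF assms(1,3,4)] by (simp add: red_def)
  ultimately show ?thesis by simp
qed

text \<open>Both components \<open>a\<close> and \<open>u - a\<close> of \<open>u\<close> lie
  outside \<open>H\<close>, the second because \<open>u\<close> lies in \<open>H\<close>. Hence
  neither \<open>A\<close> nor \<open>B\<close> is contained in \<open>H\<close>, and neither
  contains \<open>u\<close>: each loses exactly one dimension while the ambient space loses
  two.\<close>

lemma bisec_red:
  assumes "bisec (Suc k) L A B" "subspace C" "H = span (insert u C)" "u \<notin> C"
    and "a \<in> A" "u - a \<in> B" "a \<notin> H" "card L = CARD('f) * card H"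
    and span: "\<And>x. x \<in> L \<Longrightarrow> x \<notin> H \<Longrightarrow> L = span (insert x H)"
  shows "bisec k C (red u C A) (red u C B)" "u \<notin> A" "u \<notin> B"
proof -
  note D = bisecD[OF assms(1)]
  have H: "subspace H" using assms(3) by simp
  have uH: "u \<in> H" using assms(3) span_insert_mem by blast
  have b: "u - a \<notin> H" using assms(7) uH H subspace_diff[of H u "u - a"] by auto
  show uB: "u \<notin> B"
  proof
    assume "u \<in> B"
    then have "a \<in> B" using assms(6) subspace_diff[OF D(3), of u "u - a"] by simp
    then have "a = 0" using assms(5) bisec_disjoint[OF assms(1)] by blast
    then show False using assms(7) subspace_0[OF H] by simp
  qed
  show uA: "u \<notin> A"
  proof
    assume "u \<in> A"
    then have "u - a \<in> A" using assms(5) subspace_diff[OF D(2)] by simp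
    then have "u - a = 0" using assms(6) bisec_disjoint[OF assms(1)] by blast
    then show False using b subspace_0[OF H] by simp
  qed
  have card: "card A = CARD('f) * card (red u C A)" "card B = CARD('f) * card (red u C B)"
    using card_red[OF D(2,4) assms(2,3,4) uA assms(5,7)]
      card_red[OF D(3,5) assms(2,3,4) uB assms(6) b] span assms(5,6,7) b D(4,5) by auto
  have "card H = CARD('f) * card C" using card_span_insert[OF assms(2,4)] assms(3) by simp
  then have "card C = CARD('f) ^ (2 * k)" using assms(8) D(7) by simp
  moreover have "red u C A \<inter> red u C B \<subseteq> {0}"
  proof
    fix x assume "x \<in> red u C A \<inter> red u C B"
    then obtain c d where x: "x \<in> C" "x + c *s u \<in> A" "x + d *s u \<in> B" by (auto simp: red_def)
    define h where "h = c - d"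
    \<comment> \<open>The two vectors differ by \<open>h *s u\<close>, whose components are
      \<open>h *s a\<close> and \<open>h *s (u - a)\<close>. Uniqueness of components gives
      \<open>x + c *s u = h *s a\<close>, which lies in \<open>H\<close> only for
      \<open>h = 0\<close>.\<close>
    have "(x + c *s u) - h *s a = (x + d *s u) + h *s (u - a)"
      by (simp add: h_def scale_left_diff_distrib scale_right_diff_distrib algebra_simps)
    moreover have "(x + c *s u) - h *s a \<in> A"
      using x(2) assms(5) subspace_diff[OF D(2)] subspace_scale[OF D(2)] by simp
    moreover have "(x + d *s u) + h *s (u - a) \<in> B"
      using x(3) assms(6) subspace_add[OF D(3)] subspace_scale[OF D(3)] by blast
    ultimately have *: "(x + c *s u) - h *s a = 0" using bisec_disjoint[OF assms(1)] by metis
    have "x + c *s u \<in> H"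
      using x(1) uH span_insert_superset[of C u] subspace_add[OF H] subspace_scale[OF H] assms(3)
      by blast
    moreover have "h *s a = x + c *s u" using * by (simp add: algebra_simps)
    ultimately have "h = 0" using assms(7) mem_of_scale_mem[OF H, of h a] by metis
    then have "x + c *s u = 0" using * by simp
    then have "(- c) *s u = x" by (simp add: eq_neg_iff_add_eq_0 eq_commute[of _ x])
    then have "c = 0" using x(1) assms(4) mem_of_scale_mem[OF assms(2), of "- c" u] by auto
    then show "x \<in> {0}" using \<open>x + c *s u = 0\<close> by simp
  qed
  moreover have "0 \<in> red u C A \<inter> red u C B"
    using subspace_0[OF subspace_red[OF assms(2) D(2)]] subspace_0[OF subspace_red[OF assms(2) D(3)]]
    by simp
  ultimately have "red u C A \<inter> red u C B = {0}" "card C = CARD('f) ^ (2 * k)"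
    by (simp_all add: subset_antisym)
  moreover have "card (red u C A) = CARD('f) ^ k" "card (red u C B) = CARD('f) ^ k"
    using card D(8,9) by simp_all
  ultimately show "bisec k C (red u C A) (red u C B)"
    unfolding bisec_def
    by (intro conjI assms(2) subspace_red[OF assms(2) D(2)] subspace_red[OF assms(2) D(3)] red_subset)
qed

text \<open>A vector of the intersection differs by a multiple of \<open>u\<close> from a vector of
  \<open>U\<close> that represents an element of the image of \<open>A\<close>. That vector is 0,
  and what remains is a multiple of \<open>u\<close> in \<open>A\<close>.\<close>

lemma lift_complement:
  assumes "subspace C" "u \<notin> C" "subspace U" "U \<subseteq> C" "U \<inter> red u C A = {0}" "subspace A" "u \<notin> A"
  shows "span (insert u U) \<inter> A = {0}"
proof -
  have "x = 0" if x: "x \<in> span (insert u U)" "x \<in> A" for x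
  proof -
    obtain c where c: "x - c *s u \<in> U" using x(1) assms(3) by (rule span_insertE)
    then have "x - c *s u \<in> red u C A"
      using assms(4) that(2) by (auto simp: red_def intro!: exI[of _ c])
    then have "x - c *s u = 0" using c assms(5) by blast
    then have "x = c *s u" by simp
    then show ?thesis using that(2) assms(7) mem_of_scale_mem[OF assms(6), of c u] by auto
  qed
  moreover have "0 \<in> A" using subspace_0[OF assms(6)] .
  moreover have "0 \<in> span (insert u U)" using span_zero .
  ultimately show ?thesis by blast
qed

text \<open>\<open>K\<close> collects the vectors that are to survive in the quotient. The
  hyperplane can contain \<open>K\<close> and still avoid the components \<open>v\<close> and
  \<open>w\<close> of \<open>u\<close> exactly because these lie outside \<open>K\<close>.\<close>

lemma reduction:
  assumes V: "bisec (Suc k) L V1 V2" and W: "bisec (Suc k) L W1 W2"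
    and K: "subspace K" "K \<subseteq> L" "u \<in> K"
    and v: "v \<in> V1" "u - v \<in> V2" "v \<notin> K"
    and w: "w \<in> W1" "u - w \<in> W2" "w \<notin> K"
  obtains C where "bisec k C (red u C V1) (red u C V2)" "bisec k C (red u C W1) (red u C W2)"
    "K \<subseteq> span (insert u C)" "subspace C" "u \<notin> C" "u \<notin> V1" "u \<notin> V2" "u \<notin> W1" "u \<notin> W2"
    "common_compl k C {red u C V1, red u C V2, red u C W1, red u C W2} \<Longrightarrow>
       common_compl (Suc k) L {V1, V2, W1, W2}"
proof -
  note D = bisecD[OF V] and E = bisecD[OF W]
  have vL: "v \<in> L" "w \<in> L" using v(1) w(1) D(4) E(4) by auto
  obtain H where H: "subspace H" "K \<subseteq> H" "H \<subseteq> L" "v \<notin> H" "w \<notin> H" "card L = CARD('f) * card H"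
    and span: "\<And>x. x \<in> L \<Longrightarrow> x \<notin> H \<Longrightarrow> L = span (insert x H)"
    using hyperplane_avoiding[OF K(1) D(1) K(2) D(10) vL v(3) w(3)] by metis
  have uH: "u \<in> H" using K(3) H(2) by blast
  have fH: "finite H" using H(3) D(10) finite_subset by blast
  have "v \<noteq> 0" using v(3) subspace_0[OF K(1)] by auto
  have u0: "u \<noteq> 0"
  proof
    assume "u = 0"
    then have "v \<in> V2" using v(2) subspace_neg[OF D(3), of "u - v"] by simp
    then show False using bisec_disjoint[OF V v(1)] \<open>v \<noteq> 0\<close> by blast
  qed
  \<comment> \<open>A complement of the line through \<open>u\<close> in \<open>H\<close> is a
    hyperplane of \<open>H\<close> that avoids \<open>u\<close>; both avoided vectors are
    \<open>u\<close> here.\<close>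
  obtain C where C: "subspace C" "C \<subseteq> H" "u \<notin> C" "H = span (insert u C)"
  proof (rule hyperplane_avoiding[OF subspace_single_0 H(1) _ fH uH uH])
    show "{0} \<subseteq> H" using subspace_0[OF H(1)] by simp
    show "u \<notin> {0}" "u \<notin> {0}" using u0 by auto
    fix C assume "subspace C" "C \<subseteq> H" "u \<notin> C" "\<And>x. x \<in> H \<Longrightarrow> x \<notin> C \<Longrightarrow> H = span (insert x C)"
    then show thesis using uH that by blast
  qed
  note rV = bisec_red[OF V C(1,4,3) v(1,2) H(4,6) span]
  note rW = bisec_red[OF W C(1,4,3) w(1,2) H(5,6) span]
  have "common_compl (Suc k) L {V1, V2, W1, W2}"
    if cc: "common_compl k C {red u C V1, red u C V2, red u C W1, red u C W2}"
  proof -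
    obtain U where U: "subspace U" "U \<subseteq> C" "card U = CARD('f) ^ k"
      "U \<inter> red u C V1 = {0}" "U \<inter> red u C V2 = {0}" "U \<inter> red u C W1 = {0}" "U \<inter> red u C W2 = {0}"
      using cc unfolding common_compl_def by auto
    note lift = lift_complement[OF C(1,3) U(1,2)]
    have "span (insert u U) \<subseteq> L"
      using U(2) C(2) H(3) uH by (intro span_insert_least[OF D(1)]) auto
    moreover have "card (span (insert u U)) = CARD('f) ^ Suc k"
      using card_span_insert[OF U(1), of u] U(2,3) C(3) by auto
    ultimately show ?thesis unfolding common_compl_def
      using lift[OF U(4) D(2) rV(2)] lift[OF U(5) D(3) rV(3)]
        lift[OF U(6) E(2) rW(2)] lift[OF U(7) E(3) rW(3)]
      by (intro exI[of _ "span (insert u U)"]) simp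
  qed
  then show ?thesis using that[OF rV(1) rW(1) _ C(1,3) rV(2,3) rW(2,3)] H(2) C(4) by simp
qed

text \<open>Modulo \<open>u\<close> the vector \<open>a\<close> lies in \<open>A\<close> and in
  \<open>B\<close>, and it is nonzero there since \<open>u \<notin> A\<close>. With
  \<open>d = 0\<close> this preserves a meeting of \<open>A\<close> and \<open>B\<close>, with
  \<open>d = -1\<close> it creates one.\<close>

lemma red_meet:
  assumes "subspace C" "subspace A" "u \<notin> A" "a \<in> span (insert u C)" "a \<in> A" "a \<noteq> 0"
    and "a + d *s u \<in> B"
  obtains x where "x \<in> red u C A" "x \<in> red u C B" "x \<noteq> 0"
proof -
  obtain c where c: "a - c *s u \<in> C" using assms(4,1) by (rule span_insertE)
  have "a - c *s u + c *s u \<in> A" using assms(5) by simp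
  moreover have "a - c *s u + (c + d) *s u \<in> B" using assms(7) by (simp add: scale_left_distrib)
  moreover have "a - c *s u \<noteq> 0"
  proof
    assume "a - c *s u = 0"
    then have "a = c *s u" by simp
    then show False using assms(3,5,6) mem_of_scale_mem[OF assms(2), of c u] by auto
  qed
  ultimately show ?thesis using c that[of "a - c *s u"] unfolding red_def by blast
qed

lemma mem_span_two: "x \<in> span {a, b} \<Longrightarrow> \<exists>c d. x = c *s a + d *s b"
proof -
  assume "x \<in> span {a, b}"
  then have "x \<in> span (insert a (span {b}))" by (simp only: span_insert_span)
  then obtain c where "x - c *s a \<in> span {b}" using subspace_span by (rule span_insertE)
  then obtain d where "x - c *s a = d *s b" by (auto simp: span_singleton)
  then have "x = c *s a + d *s b" by (simp add: algebra_simps)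
  then show ?thesis by blast
qed

lemma mem_span_three: "x \<in> span {a, b, e} \<Longrightarrow> \<exists>c d g. x = c *s a + d *s b + g *s e"
proof -
  assume "x \<in> span {a, b, e}"
  then have "x \<in> span (insert a (span {b, e}))" by (simp only: span_insert_span)
  then obtain c where "x - c *s a \<in> span {b, e}" using subspace_span by (rule span_insertE)
  then obtain d g where "x - c *s a = d *s b + g *s e" using mem_span_two by blast
  then have "x = c *s a + d *s b + g *s e" by (simp add: algebra_simps)
  then show ?thesis by blast
qed

lemma subspace_eq_line:
  assumes "subspace A" "card A = CARD('f)" "x \<in> A" "x \<noteq> 0"
  shows "A = span {x}"
proof -
  have "card (span {x}) = CARD('f) ^ 1"
    using card_span_independent[of "{x}"] assms(4) by (simp add: independent_insert)
  moreover have "span {x} \<subseteq> A" using span_minimal[of "{x}" A] assms(1,3) by simp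
  moreover have "finite A" using assms(2) by (intro card_ge_0_finite) simp
  ultimately show ?thesis using card_subset_eq[of A "span {x}"] assms(2) by simp
qed

section \<open>Fields with at least three elements\<close>

definition universally_common_compl :: "nat \<Rightarrow> bool" where
  "universally_common_compl k \<longleftrightarrow> (\<forall>L V1 V2 W1 W2. bisec k L V1 V2 \<longrightarrow> bisec k L W1 W2 \<longrightarrow>
     common_compl k L {V1, V2, W1, W2})"

lemma universally_common_complD:
  "universally_common_compl k \<Longrightarrow> bisec k L V1 V2 \<Longrightarrow> bisec k L W1 W2 \<Longrightarrow>
     common_compl k L {V1, V2, W1, W2}"
  by (simp add: universally_common_compl_def)

lemma universally_common_compl_0: "universally_common_compl 0"
  unfolding universally_common_compl_def
proof (intro allI impI)
  fix L V1 V2 W1 W2 assume V: "bisec 0 L V1 V2" and W: "bisec 0 L W1 W2"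
  show "common_compl 0 L {V1, V2, W1, W2}"
    unfolding common_compl_def using bisecD(13-15)[OF V] bisecD(14,15)[OF W]
    by (intro exI[of _ "{0}"]) simp
qed

text \<open>This is the case where \<open>K\<close> is the line through \<open>u\<close>. A
  component of \<open>u\<close> on that line would be a multiple of \<open>u\<close> inside a
  subspace not containing \<open>u\<close>, hence 0, and \<open>u\<close> would lie in the other
  component of the bisection.\<close>

lemma reduction_point:
  assumes "bisec (Suc k) L V1 V2" "bisec (Suc k) L W1 W2"
    and u: "u \<in> L" "u \<notin> V1" "u \<notin> V2" "u \<notin> W1" "u \<notin> W2"
  obtains C where "bisec k C (red u C V1) (red u C V2)" "bisec k C (red u C W1) (red u C W2)"
    "common_compl k C {red u C V1, red u C V2, red u C W1, red u C W2} \<Longrightarrow>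
       common_compl (Suc k) L {V1, V2, W1, W2}"
proof -
  note D = bisecD[OF assms(1)] and E = bisecD[OF assms(2)]
  have K: "span {u} \<subseteq> L" using span_minimal[of "{u}" L] u(1) D(1) by simp
  have notin: "a \<notin> span {u}" if "subspace A" "a \<in> A" "u \<notin> A" "u \<notin> B" "u - a \<in> B" for a A B
  proof
    assume "a \<in> span {u}"
    then obtain c where "a = c *s u" by (auto simp: span_singleton)
    then have "c = 0" using that(2,3) mem_of_scale_mem[OF that(1), of c u] by blast
    then show False using \<open>a = c *s u\<close> that(4,5) by simp
  qed
  obtain v where v: "v \<in> V1" "u - v \<in> V2" using bisec_decomp[OF assms(1) u(1)] by metis
  obtain w where w: "w \<in> W1" "u - w \<in> W2" using bisec_decomp[OF assms(2) u(1)] by metis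
  have v': "v \<notin> span {u}" using notin[OF D(2) v(1) u(2,3) v(2)] .
  have w': "w \<notin> span {u}" using notin[OF E(2) w(1) u(4,5) w(2)] .
  show ?thesis
    using reduction[OF assms(1,2) subspace_span K span_base v v' w w'] that by (metis insertI1)
qed

lemma common_compl_step:
  assumes "universally_common_compl k" "bisec (Suc k) L V1 V2" "bisec (Suc k) L W1 W2"
    and "u \<in> L" "u \<notin> V1" "u \<notin> V2" "u \<notin> W1" "u \<notin> W2"
  shows "common_compl (Suc k) L {V1, V2, W1, W2}"
  using reduction_point[OF assms(2-)] universally_common_complD[OF assms(1)] by metis

text \<open>The bound says that four times q^(k+1) is at most q^(2k+2); since the four subspaces
  share 0, a vector outside them is left.\<close>

lemma universally_common_compl_Suc:
  assumes "universally_common_compl k" "4 \<le> CARD('f) ^ Suc k"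
  shows "universally_common_compl (Suc k)"
  unfolding universally_common_compl_def
proof (intro allI impI)
  fix L V1 V2 W1 W2 assume V: "bisec (Suc k) L V1 V2" and W: "bisec (Suc k) L W1 W2"
  note D = bisecD[OF V] and E = bisecD[OF W]
  have "4 * CARD('f) ^ Suc k \<le> CARD('f) ^ Suc k * CARD('f) ^ Suc k"
    using assms(2) by (rule mult_right_mono) simp
  also have "\<dots> = card L" using D(7) by (simp add: power_add[symmetric] mult_2)
  finally have "4 * CARD('f) ^ Suc k \<le> card L" .
  then have "card V1 + card V2 + card W1 + card W2 < card L + 3 * card {0 :: 'v}"
    using D(8,9) E(8,9) by simp
  then obtain u where "u \<in> L" "u \<notin> V1" "u \<notin> V2" "u \<notin> W1" "u \<notin> W2"
    by (rule not_union_four[where Z = "{0}"])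
      (use D(11,12,14,15) E(11,12,14,15) in simp_all)
  then show "common_compl (Suc k) L {V1, V2, W1, W2}" by (rule common_compl_step[OF assms(1) V W])
qed

lemma universally_common_compl_mono:
  assumes "universally_common_compl j" "j \<le> k" "4 \<le> CARD('f) ^ Suc j"
  shows "universally_common_compl k"
  using assms(2)
proof (induction k rule: dec_induct)
  case (step k)
  have "CARD('f) ^ Suc j \<le> CARD('f) ^ Suc k"
    using step.hyps card_field_ge_2 by (intro power_increasing) auto
  then have "4 \<le> CARD('f) ^ Suc k" using assms(3) by (rule order_trans[rotated])
  then show ?case by (rule universally_common_compl_Suc[OF step.IH])
qed (rule assms(1))

text \<open>A plane over at least three scalars has at least four lines, and the two bisections use
  at most three.\<close>

lemma common_compl_1_shared:
  assumes "3 \<le> CARD('f)" "bisec 1 L A V2" "bisec 1 L A W2"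
  shows "common_compl 1 L {A, V2, A, W2}"
proof -
  note D = bisecD[OF assms(2)] and E = bisecD[OF assms(3)]
  have "3 * CARD('f) \<le> CARD('f) * CARD('f)" using assms(1) by (rule mult_right_mono) simp
  moreover have "card L = CARD('f) * CARD('f)" "card A = CARD('f)" "card V2 = CARD('f)"
    "card W2 = CARD('f)" "card {0 :: 'v} = 1"
    using D(7-9) E(9) by (simp_all add: power2_eq_square)
  ultimately have "card A + card V2 + card W2 + card {0 :: 'v} < card L + 3 * card {0 :: 'v}"
    by linarith
  then obtain u where "u \<in> L" "u \<notin> A" "u \<notin> V2" "u \<notin> W2" "u \<notin> {0}"
    by (rule not_union_four[where Z = "{0}"])
      (use D(11,12,14,15) E(11,12,14,15) in simp_all)
  then show ?thesis
    using common_compl_step[OF universally_common_compl_0, of L A V2 A W2] assms(2,3) by simp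
qed

lemma common_compl_1_meet:
  assumes "3 \<le> CARD('f)" "bisec 1 L V1 V2" "bisec 1 L W1 W2" "x \<in> V1" "x \<in> W1" "x \<noteq> 0"
  shows "common_compl 1 L {V1, V2, W1, W2}"
proof -
  note D = bisecD[OF assms(2)] and E = bisecD[OF assms(3)]
  have "V1 = W1" using subspace_eq_line[OF D(2) _ assms(4,6)] subspace_eq_line[OF E(2) _ assms(5,6)]
    D(8) E(8) by simp
  then show ?thesis using common_compl_1_shared[of L V1 V2 W2] assms by simp
qed

text \<open>The vector \<open>e\<close> is put into the hyperplane along with \<open>u\<close>, so
  that \<open>V1\<close> and \<open>W1\<close> still meet in the quotient and
  \<open>common_compl_1_meet\<close> applies. The \<open>V1\<close>-component of \<open>u\<close>
  stays out of \<open>span {u, e}\<close> if \<open>u\<close> avoids \<open>V1\<close> and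
  \<open>span (insert e V2)\<close>; likewise for the other bisection.\<close>

lemma common_compl_2_meet:
  assumes "CARD('f) = 3" "bisec 2 L V1 V2" "bisec 2 L W1 W2" and e: "e \<in> V1" "e \<in> W1" "e \<noteq> 0"
  shows "common_compl 2 L {V1, V2, W1, W2}"
proof -
  note D = bisecD[OF assms(2)] and E = bisecD[OF assms(3)]
  have eL: "e \<in> L" using e(1) D(4) by blast
  have e2: "e \<notin> V2" "e \<notin> W2" using e bisec_disjoint[OF assms(2)] bisec_disjoint[OF assms(3)] by auto
  let ?V = "span (insert e V2)" and ?W = "span (insert e W2)"
  have sub: "?V \<subseteq> L" "?W \<subseteq> L" using span_insert_least D(1,5) E(5) eL by auto
  have fin: "finite ?V" "finite ?W" using sub D(10) finite_subset by auto
  \<comment> \<open>The count is 27 + 9 + 27 + 9 = 72 against 81 + 3.\<close>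
  have "card ?V + card V1 + card ?W + card W1 < card L + 3 * card {0 :: 'v}"
    using card_span_insert[OF D(3) e2(1)] card_span_insert[OF E(3) e2(2)] D(7-9) E(8,9) assms(1)
    by simp
  then obtain u where u: "u \<in> L" "u \<notin> ?V" "u \<notin> V1" "u \<notin> ?W" "u \<notin> W1"
    by (rule not_union_four[where Z = "{0}"]) (use D(11,14) E(11,14) fin span_zero in simp_all)
  have *: "v \<notin> span {u, e}"
    if "bisec 2 L A B" "v \<in> A" "u - v \<in> B" "e \<in> A" "u \<notin> span (insert e B)" "u \<notin> A" for v A B
  proof
    note F = bisecD[OF that(1)]
    assume "v \<in> span {u, e}"
    then obtain c d where c: "v = c *s u + d *s e" using mem_span_two by blast
    then have "v - d *s e = c *s u" by simp
    moreover have "v - d *s e \<in> A" using subspace_diff[OF F(2) that(2) subspace_scale[OF F(2) that(4)]] .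
    ultimately have "c = 0" using that(6) mem_of_scale_mem[OF F(2), of c u] by auto
    then have "u - d *s e \<in> B" using c that(3) by simp
    then show False using span_insertI[OF F(3)] that(5) by blast
  qed
  obtain v where v: "v \<in> V1" "u - v \<in> V2" using bisec_decomp[OF assms(2) u(1)] by metis
  obtain w where w: "w \<in> W1" "u - w \<in> W2" using bisec_decomp[OF assms(3) u(1)] by metis
  have v': "v \<notin> span {u, e}" using *[OF assms(2) v e(1) u(2,3)] .
  have w': "w \<notin> span {u, e}" using *[OF assms(3) w e(2) u(4,5)] .
  have K: "span {u, e} \<subseteq> L" "u \<in> span {u, e}" "e \<in> span {u, e}"
    using span_minimal[of "{u, e}" L] u(1) eL D(1) by (auto intro: span_base)
  obtain C where C: "bisec 1 C (red u C V1) (red u C V2)" "bisec 1 C (red u C W1) (red u C W2)"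
    "span {u, e} \<subseteq> span (insert u C)" "subspace C" "u \<notin> V1"
    "common_compl 1 C {red u C V1, red u C V2, red u C W1, red u C W2} \<Longrightarrow>
       common_compl 2 L {V1, V2, W1, W2}"
    using reduction[of 1 L V1 V2 W1 W2, OF _ _ subspace_span K(1,2) v v' w w'] assms(2,3)
    by (metis Suc_1)
  have "e + 0 *s u \<in> W1" "e \<in> span (insert u C)" using e(2) C(3) K(3) by auto
  then obtain x where "x \<in> red u C V1" "x \<in> red u C W1" "x \<noteq> 0"
    using red_meet[OF C(4) D(2) C(5) _ e(1,3)] by metis
  then show ?thesis using C(6) common_compl_1_meet[OF _ C(1,2)] assms(1) by simp
qed

lemma universally_common_compl_2:
  assumes "CARD('f) = 3"
  shows "universally_common_compl 2"
  unfolding universally_common_compl_def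
proof (intro allI impI)
  fix L V1 V2 W1 W2 assume V: "bisec 2 L V1 V2" and W: "bisec 2 L W1 W2"
  note D = bisecD[OF V] and E = bisecD[OF W]
  consider e where "e \<in> V1" "e \<in> W1" "e \<noteq> 0" | e where "e \<in> V1" "e \<in> W2" "e \<noteq> 0"
    | e where "e \<in> V2" "e \<in> W1" "e \<noteq> 0"
    | "\<And>x. x \<in> V1 \<Longrightarrow> x \<in> W1 \<Longrightarrow> x = 0" "\<And>x. x \<in> V1 \<Longrightarrow> x \<in> W2 \<Longrightarrow> x = 0"
      "\<And>x. x \<in> V2 \<Longrightarrow> x \<in> W1 \<Longrightarrow> x = 0"
    by blast
  then show "common_compl 2 L {V1, V2, W1, W2}"
  proof cases
    case 1
    then show ?thesis using common_compl_2_meet[OF assms V W] by blast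
  next
    case 2
    then show ?thesis using common_compl_2_meet[OF assms V bisec_commute[OF W]]
      by (metis insert_commute)
  next
    case 3
    then show ?thesis using common_compl_2_meet[OF assms bisec_commute[OF V] W]
      by (metis insert_commute)
  next
    case 4
    have "\<not> W1 \<subseteq> {0}" using E(8) assms card_mono[of "{0}" W1] by auto
    then obtain b where b: "b \<in> W1" "b \<noteq> 0" by blast
    have bL: "b \<in> L" using b(1) E(4) by blast
    obtain b1 where b1: "b1 \<in> V1" "b - b1 \<in> V2" using bisec_decomp[OF V bL] by metis
    have b10: "b1 \<noteq> 0" using b1(2) 4(3) b by auto
    have bW2: "b \<notin> W2" using bisec_disjoint[OF W] b by blast
    \<comment> \<open>The vector \<open>a\<close> will have to avoid \<open>span {b1}\<close>, to
      keep the \<open>V1\<close>-component of \<open>a + b\<close> out of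
      \<open>span {a, b}\<close>, and \<open>span (insert b W2)\<close>, to do the same for the
      \<open>W1\<close>-component.\<close>
    have "\<not> V1 \<subseteq> span {b1}"
    proof
      assume "V1 \<subseteq> span {b1}"
      moreover have "card (span {b1}) = CARD('f) ^ 1"
        using card_span_independent[of "{b1}"] b10 by (simp add: independent_insert)
      moreover have "finite (span {b1})" using calculation(2) assms by (intro card_ge_0_finite) simp
      ultimately show False using card_mono[of "span {b1}" V1] D(8) assms by simp
    qed
    moreover have "\<not> V1 \<subseteq> span (insert b W2)"
    proof
      assume *: "V1 \<subseteq> span (insert b W2)"
      have "finite (span (insert b W2))"
        using span_insert_least[OF D(1) E(5) bL] D(10) finite_subset by auto
      moreover have "V1 \<inter> W2 = {0}" using 4(2) D(14) E(15) by blast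
      ultimately show False
        using card_direct_sum_le(1)[OF D(2) E(3) subspace_span * span_insert_superset]
          card_span_insert[OF E(3) bW2] D(8) E(9) assms by simp
    qed
    ultimately obtain a where a: "a \<in> V1" "a \<notin> span {b1}" "a \<notin> span (insert b W2)"
      by (rule not_union_two_proper[OF D(2) subspace_span subspace_span])
    have a0: "a \<noteq> 0" using a(2) span_zero by auto
    have aL: "a \<in> L" using a(1) D(4) by blast
    obtain a1 where a1: "a1 \<in> W1" "a - a1 \<in> W2" using bisec_decomp[OF W aL] by metis
    \<comment> \<open>Modulo \<open>u\<close> the vector \<open>a\<close> of \<open>V1\<close>
      equals \<open>- b\<close>, which lies in \<open>W1\<close>: the quotient has the meeting that
      is missing here.\<close>
    define u where "u = a + b"
    let ?K = "span {a, b}"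
    have K: "?K \<subseteq> L" "u \<in> ?K" "a \<in> ?K"
      using span_minimal[of "{a, b}" L] aL bL D(1) unfolding u_def
      by (auto intro: span_base span_add)
    have v: "a + b1 \<in> V1" "u - (a + b1) \<in> V2"
      using subspace_add[OF D(2) a(1) b1(1)] b1(2) by (simp_all add: u_def)
    have w: "b + a1 \<in> W1" "u - (b + a1) \<in> W2"
      using subspace_add[OF E(2) b(1) a1(1)] a1(2) by (simp_all add: u_def)
    have v': "a + b1 \<notin> ?K"
    proof
      assume "a + b1 \<in> ?K"
      then obtain c d where c: "a + b1 = c *s a + d *s b" using mem_span_two by blast
      then have "b1 - (c - 1) *s a = d *s b"
        by (simp add: scale_left_diff_distrib algebra_simps)
      moreover have "b1 - (c - 1) *s a \<in> V1"
        using subspace_diff[OF D(2) b1(1) subspace_scale[OF D(2) a(1)]] .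
      ultimately have "b1 - (c - 1) *s a = 0" using 4(1) subspace_scale[OF E(2) b(1), of d] by metis
      then have *: "b1 = (c - 1) *s a" by simp
      then have "c - 1 \<noteq> 0" using b10 by auto
      then have "a \<in> span {b1}"
        using mem_of_scale_mem[OF subspace_span, of "c - 1" a "{b1}"] * span_base[of b1 "{b1}"] by simp
      then show False using a(2) by blast
    qed
    have w': "b + a1 \<notin> ?K"
    proof
      assume "b + a1 \<in> ?K"
      then obtain c d where c: "b + a1 = c *s a + d *s b" using mem_span_two by blast
      then have "a1 - (d - 1) *s b = c *s a"
        by (simp add: scale_left_diff_distrib algebra_simps)
      moreover have "a1 - (d - 1) *s b \<in> W1"
        using subspace_diff[OF E(2) a1(1) subspace_scale[OF E(2) b(1)]] .
      ultimately have "a1 - (d - 1) *s b = 0" using 4(1) subspace_scale[OF D(2) a(1), of c] by metis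
      then have "a - (d - 1) *s b \<in> W2" using a1(2) by simp
      then show False using span_insertI[OF E(3)] a(3) by blast
    qed
    obtain C where C: "bisec 1 C (red u C V1) (red u C V2)" "bisec 1 C (red u C W1) (red u C W2)"
      "?K \<subseteq> span (insert u C)" "subspace C" "u \<notin> V1"
      "common_compl 1 C {red u C V1, red u C V2, red u C W1, red u C W2} \<Longrightarrow>
         common_compl 2 L {V1, V2, W1, W2}"
      using reduction[of 1 L V1 V2 W1 W2, OF _ _ subspace_span K(1,2) v v' w w'] V W
      by (metis Suc_1)
    have "a + (-1) *s u \<in> W1" using subspace_neg[OF E(2) b(1)] by (simp add: u_def)
    moreover have "a \<in> span (insert u C)" using C(3) K(3) by blast
    ultimately obtain x where "x \<in> red u C V1" "x \<in> red u C W1" "x \<noteq> 0"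
      using red_meet[OF C(4) D(2) C(5) _ a(1) a0] by metis
    then show ?thesis using C(6) common_compl_1_meet[OF _ C(1,2)] assms by simp
  qed
qed

section \<open>The field with two elements\<close>

text \<open>The common vector forces \<open>V = W\<close>, so only two of the at least three lines
  of the plane are in use. This covers the field with two elements.\<close>

lemma common_compl_1_pair:
  assumes "bisec 1 L A V" "bisec 1 L A W" "x \<in> V" "x \<in> W" "x \<noteq> 0"
  shows "common_compl 1 L {A, V, A, W}"
proof -
  note D = bisecD[OF assms(1)] and E = bisecD[OF assms(2)]
  have VW: "V = W" using subspace_eq_line[OF D(3) _ assms(3,5)] subspace_eq_line[OF E(3) _ assms(4,5)]
    D(9) E(9) by simp
  have "2 * CARD('f) \<le> CARD('f) * CARD('f)" using card_field_ge_2 by (rule mult_right_mono) simp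
  moreover have "card L = CARD('f) * CARD('f)" "card A = CARD('f)" "card V = CARD('f)"
    "card {0 :: 'v} = 1"
    using D(7-9) by (simp_all add: power2_eq_square)
  ultimately have "card A + card V + card {0 :: 'v} + card {0 :: 'v} < card L + 3 * card {0 :: 'v}"
    by linarith
  then obtain u where "u \<in> L" "u \<notin> A" "u \<notin> V" "u \<notin> {0}" "u \<notin> {0}"
    by (rule not_union_four[where Z = "{0}"]) (use D(11,12,14,15) in simp_all)
  then show ?thesis
    using common_compl_step[OF universally_common_compl_0, of L A V A W] assms(1,2) VW by simp
qed

text \<open>The component \<open>A\<close> stays shared in the quotient, but a plane over two
  elements needs a second coincidence: \<open>V\<close> and \<open>W\<close> have to share a nonzero
  vector modulo \<open>u\<close>. Either they already do before the reduction, or \<open>u\<close>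
  is chosen so that they meet.\<close>

lemma common_compl_2_shared:
  assumes "CARD('f) = 2" and V: "bisec 2 L A V" and W: "bisec 2 L A W"
  shows "common_compl 2 L {A, V, A, W}"
proof -
  note D = bisecD[OF V] and E = bisecD[OF W]
  \<comment> \<open>Here \<open>e\<close> is the vector whose image becomes common to
    \<open>V\<close> and \<open>W\<close>; the quotient is then in the situation of
    \<open>common_compl_1_pair\<close>.\<close>
  have *: thesis if K: "subspace K" "K \<subseteq> L" "u \<in> K" and v: "v \<in> A" "u - v \<in> V" "v \<notin> K"
      and w: "w \<in> A" "u - w \<in> W" "w \<notin> K" and e: "e \<in> K" "e \<in> V" "e \<noteq> 0" "e + d *s u \<in> W"
      and "common_compl 2 L {A, V, A, W} \<Longrightarrow> thesis"
    for K u v w e d thesis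
  proof -
    obtain C where C: "bisec 1 C (red u C A) (red u C V)" "bisec 1 C (red u C A) (red u C W)"
      "K \<subseteq> span (insert u C)" "subspace C" "u \<notin> V"
      "common_compl 1 C {red u C A, red u C V, red u C A, red u C W} \<Longrightarrow>
         common_compl 2 L {A, V, A, W}"
      using reduction[of 1 L A V A W, OF _ _ K v w] V W by (metis Suc_1)
    have "e \<in> span (insert u C)" using C(3) e(1) by blast
    then obtain x where "x \<in> red u C V" "x \<in> red u C W" "x \<noteq> 0"
      using red_meet[OF C(4) D(3) C(5) _ e(2-4)] by metis
    then show thesis using that(14) C(6) common_compl_1_pair[OF C(1,2)] by blast
  qed
  show ?thesis
  proof (cases "\<exists>e. e \<in> V \<and> e \<in> W \<and> e \<noteq> 0")
    case True
    then obtain e where e: "e \<in> V" "e \<in> W" "e \<noteq> 0" by blast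
    have eL: "e \<in> L" and eA: "e \<notin> A" using e D(5) bisec_disjoint[OF V] by auto
    let ?A = "span (insert e A)"
    have sub: "?A \<subseteq> L" using span_insert_least[OF D(1,4) eL] .
    then have fin: "finite ?A" using D(10) finite_subset by auto
    \<comment> \<open>The count is 8 + 4 + 4 + 1 = 17 against 16 + 3.\<close>
    have "card ?A + card V + card W + card {0 :: 'v} < card L + 3 * card {0 :: 'v}"
      using card_span_insert[OF D(2) eA] D(7-9) E(9) assms(1) by simp
    then obtain u where u: "u \<in> L" "u \<notin> ?A" "u \<notin> V" "u \<notin> W" "u \<notin> {0}"
      by (rule not_union_four[where Z = "{0}"]) (use D(12,15) E(12,15) fin span_zero in simp_all)
    have notin: "v \<notin> span {u, e}"
      if "subspace B" "v \<in> A" "u - v \<in> B" "e \<in> B" "u \<notin> B" for v B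
    proof
      assume "v \<in> span {u, e}"
      then obtain c d where c: "v = c *s u + d *s e" using mem_span_two by blast
      then have "(u - v) + d *s e = (1 - c) *s u" by (simp add: scale_left_diff_distrib)
      then have "(1 - c) *s u \<in> B"
        using subspace_add[OF that(1,3) subspace_scale[OF that(1,4), of d]] by simp
      then have "c = 1" using that(5) mem_of_scale_mem[OF that(1), of "1 - c" u] by auto
      then have "u - (- d) *s e \<in> A" using c that(2) by simp
      then show False using span_insertI[OF D(2)] u(2) by blast
    qed
    obtain v where v: "v \<in> A" "u - v \<in> V" using bisec_decomp[OF V u(1)] by metis
    obtain w where w: "w \<in> A" "u - w \<in> W" using bisec_decomp[OF W u(1)] by metis
    have K: "span {u, e} \<subseteq> L" "u \<in> span {u, e}" "e \<in> span {u, e}"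
      using span_minimal[of "{u, e}" L] u(1) eL D(1) by (auto intro: span_base)
    have "e + 0 *s u \<in> W" using e(2) by simp
    then show ?thesis
      using *[OF subspace_span K(1,2) v notin[OF D(3) v e(1) u(3)] w notin[OF E(3) w e(2) u(4)]
          K(3) e(1,3)] by blast
  next
    case False
    then have VW: "x = 0" if "x \<in> V" "x \<in> W" for x using that by blast
    have "\<not> W \<subseteq> {0}" using E(9) assms(1) card_mono[of "{0}" W] by auto
    then obtain b' where b': "b' \<in> W" "b' \<noteq> 0" by blast
    have bL': "b' \<in> L" using b'(1) E(5) by blast
    obtain p where p: "p \<in> A" "b' - p \<in> V" using bisec_decomp[OF V bL'] by metis
    have p0: "p \<noteq> 0" using p(2) VW b' by auto
    have q0: "b' - p \<noteq> 0" using p(1) b' bisec_disjoint[OF W] by auto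
    \<comment> \<open>The only condition on \<open>b\<close> is that it is no multiple of the
      \<open>V\<close>-component of \<open>b'\<close>. It keeps both \<open>p\<close> and
      \<open>p'\<close> out of \<open>span {b, b'}\<close>.\<close>
    have "\<not> V \<subseteq> span {b' - p}"
    proof
      assume "V \<subseteq> span {b' - p}"
      moreover have "card (span {b' - p}) = CARD('f) ^ 1"
        using card_span_independent[of "{b' - p}"] q0 by (simp add: independent_insert)
      moreover have "finite (span {b' - p})"
        using calculation(2) assms(1) by (intro card_ge_0_finite) simp
      ultimately show False using card_mono[of "span {b' - p}" V] D(9) assms(1) by simp
    qed
    then obtain b where b: "b \<in> V" "b \<notin> span {b' - p}" by blast
    have b0: "b \<noteq> 0" using b(2) span_zero by auto
    have bL: "b \<in> L" using b(1) D(5) by blast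
    obtain p' where p': "p' \<in> A" "b - p' \<in> W" using bisec_decomp[OF W bL] by metis
    have p0': "p' \<noteq> 0" using p'(2) VW b(1) b0 by auto
    \<comment> \<open>Since \<open>b\<close> lies in \<open>V\<close> and \<open>b'\<close> in
      \<open>W\<close>, the \<open>A\<close>-component of \<open>u\<close> is \<open>p\<close> in
      the first bisection and \<open>p'\<close> in the second.\<close>
    define u where "u = b + b'"
    let ?K = "span {b, b'}"
    have K: "?K \<subseteq> L" "u \<in> ?K" "b \<in> ?K"
      using span_minimal[of "{b, b'}" L] bL bL' D(1) unfolding u_def
      by (auto intro: span_base span_add)
    have v: "u - p \<in> V" using subspace_add[OF D(3) b(1) p(2)] by (simp add: u_def algebra_simps)
    have w: "u - p' \<in> W" using subspace_add[OF E(3) b'(1) p'(2)] by (simp add: u_def algebra_simps)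
    have line: False if "b = c *s (b' - p)" for c
      using that b(2) span_scale[OF span_base[of "b' - p" "{b' - p}"], of c] by simp
    have v': "p \<notin> ?K"
    proof
      assume "p \<in> ?K"
      then obtain c d where c: "p = c *s b + d *s b'" using mem_span_two by blast
      have "c *s b + d *s (b' - p) = (c *s b + d *s b') - d *s p"
        by (simp add: scale_right_diff_distrib)
      also have "\<dots> = (1 - d) *s p" using c by (simp add: scale_left_diff_distrib)
      finally have d: "c *s b + d *s (b' - p) = (1 - d) *s p" .
      moreover have "c *s b + d *s (b' - p) \<in> V"
        using subspace_add[OF D(3) subspace_scale[OF D(3) b(1)] subspace_scale[OF D(3) p(2)]] .
      moreover have "(1 - d) *s p \<in> A" using subspace_scale[OF D(2) p(1)] .
      ultimately have "(1 - d) *s p = 0" using bisec_disjoint[OF V] by metis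
      then have "d = 1" using p0 by simp
      then have *: "c *s b = - (b' - p)" using d by (simp add: eq_neg_iff_add_eq_0 del: minus_diff_eq)
      have "c \<noteq> 0" using * q0 by auto
      have "b = inverse c *s (c *s b)" using \<open>c \<noteq> 0\<close> by simp
      also have "\<dots> = (- inverse c) *s (b' - p)" unfolding * by (simp only: scale_minus_left scale_minus_right)
      finally show False by (rule line)
    qed
    have w': "p' \<notin> ?K"
    proof
      assume "p' \<in> ?K"
      then obtain c d where c: "p' = c *s b + d *s b'" using mem_span_two by blast
      have "c *s (b - p') + d *s b' = (c *s b + d *s b') - c *s p'"
        by (simp add: scale_right_diff_distrib)
      also have "\<dots> = (1 - c) *s p'" using c by (simp add: scale_left_diff_distrib)
      finally have d: "c *s (b - p') + d *s b' = (1 - c) *s p'" .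
      moreover have "c *s (b - p') + d *s b' \<in> W"
        using subspace_add[OF E(3) subspace_scale[OF E(3) p'(2)] subspace_scale[OF E(3) b'(1)]] .
      moreover have "(1 - c) *s p' \<in> A" using subspace_scale[OF D(2) p'(1)] .
      ultimately have "(1 - c) *s p' = 0" using bisec_disjoint[OF W] by metis
      then have "c = 1" using p0' by simp
      then have "p' = b + d *s b'" using c by simp
      then have *: "b + d *s (b' - p) = p' - d *s p" by (simp add: scale_right_diff_distrib)
      moreover have "b + d *s (b' - p) \<in> V"
        using subspace_add[OF D(3) b(1) subspace_scale[OF D(3) p(2)]] .
      moreover have "p' - d *s p \<in> A"
        using subspace_diff[OF D(2) p'(1) subspace_scale[OF D(2) p(1)]] .
      ultimately have "b + d *s (b' - p) = 0" using bisec_disjoint[OF V] by metis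
      then have "b = (- d) *s (b' - p)" by (simp add: eq_neg_iff_add_eq_0)
      then show False by (rule line)
    qed
    have "b + (-1) *s u \<in> W" using subspace_neg[OF E(3) b'(1)] by (simp add: u_def)
    then show ?thesis using *[OF subspace_span K(1,2) p(1) v v' p'(1) w w' K(3) b(1) b0] by blast
  qed
qed

lemma card_span_two:
  assumes "e \<noteq> 0" "e' \<notin> span {e}"
  shows "card (span {e', e}) = CARD('f) ^ 2"
proof -
  have "card (span {e}) = CARD('f)"
    using card_span_independent[of "{e}"] assms(1) by (simp add: independent_insert)
  then show ?thesis
    using card_span_insert[OF subspace_span assms(2)]
    by (simp add: span_insert_span power2_eq_square)
qed

text \<open>Here \<open>V1\<close> is spanned by \<open>e\<close> and \<open>e'\<close>, and
  \<open>f\<close>, \<open>f'\<close> complete bases of \<open>W1\<close> and \<open>W2\<close>.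
  Complements of both \<open>V1\<close> and \<open>V2\<close> are the graphs of isomorphisms from
  \<open>V2\<close> to \<open>V1\<close>; the one used sends \<open>f - x\<close> to
  \<open>s\<close> and \<open>f' - y\<close> to \<open>t\<close>. Avoiding \<open>W1\<close> and
  \<open>W2\<close> then amounts to a condition on one coefficient of \<open>s\<close> and one of
  \<open>t\<close>, which can be met over every field.\<close>

lemma common_compl_2_cross:
  assumes V: "bisec 2 L V1 V2" and W: "bisec 2 L W1 W2"
    and e: "e \<in> V1" "e \<in> W1" "e \<noteq> 0" and e': "e' \<in> V1" "e' \<in> W2" "e' \<noteq> 0"
  shows "common_compl 2 L {V1, V2, W1, W2}"
proof -
  note D = bisecD[OF V] and E = bisecD[OF W]
  have q: "CARD('f) ^ 1 < CARD('f) ^ 2" using card_field_ge_2 by (intro power_strict_increasing) auto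
  have ee': "c = 0 \<and> d = 0" if "c *s e + d *s e' = 0" for c d
  proof -
    have "c *s e = (- d) *s e'" using that by (simp add: eq_neg_iff_add_eq_0)
    then have "c *s e = 0"
      using subspace_scale[OF E(2) e(2), of c] subspace_scale[OF E(3) e'(2), of "- d"]
        bisec_disjoint[OF W] by metis
    then show ?thesis using that e(3) e'(3) by simp
  qed
  have e'e: "e' \<notin> span {e}"
  proof
    assume "e' \<in> span {e}"
    then obtain c where "e' = c *s e" by (auto simp: span_singleton)
    then show False using ee'[of "- c" 1] by simp
  qed
  have "span {e', e} \<subseteq> V1" using span_minimal[of "{e', e}" V1] e(1) e'(1) D(2) by simp
  then have "span {e', e} = V1"
    using card_subset_eq[OF D(11)] card_span_two[OF e(3) e'e] D(8) by simp
  then have V1: "\<exists>c d. z = c *s e + d *s e'" if "z \<in> V1" for z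
    using that mem_span_two[of z e e'] by (simp add: insert_commute)
  have notsub: "\<not> B \<subseteq> span {x}" if "card B = CARD('f) ^ 2" "x \<noteq> 0" for B :: "'v set" and x
  proof
    assume "B \<subseteq> span {x}"
    moreover have c: "card (span {x}) = CARD('f) ^ 1"
      using card_span_independent[of "{x}"] that(2) by (simp add: independent_insert)
    moreover have "finite (span {x})" using c by (intro card_ge_0_finite) simp
    ultimately show False using card_mono[of "span {x}" B] q that(1) by simp
  qed
  obtain f where f: "f \<in> W1" "f \<notin> span {e}" using notsub[OF E(8) e(3)] by blast
  obtain f' where f': "f' \<in> W2" "f' \<notin> span {e'}" using notsub[OF E(9) e'(3)] by blast
  have line: "c = 0" if "c *s y \<in> span {z}" "y \<notin> span {z}" for c y z
    using that mem_of_scale_mem[OF subspace_span, of c y "{z}"] by blast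
  have split: "c *s f + a *s e = 0 \<and> d *s f' + b *s e' = 0"
    if "c *s f + a *s e = d *s f' + b *s e'" for a b c d
  proof -
    have "c *s f + a *s e \<in> W1" "d *s f' + b *s e' \<in> W2"
      using subspace_add[OF E(2) subspace_scale[OF E(2) f(1)] subspace_scale[OF E(2) e(2)]]
        subspace_add[OF E(3) subspace_scale[OF E(3) f'(1)] subspace_scale[OF E(3) e'(2)]] by auto
    then show ?thesis using that bisec_disjoint[OF W] by metis
  qed
  have lf: "c = 0" if "c *s f + a *s e = 0" for c a
  proof -
    have "c *s f = (- a) *s e" using that by (simp add: eq_neg_iff_add_eq_0)
    then show ?thesis using line[OF _ f(2), of c] span_scale[OF span_base[of e "{e}"], of "- a"] by simp
  qed
  have lf': "c = 0" if "c *s f' + a *s e' = 0" for c a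
  proof -
    have "c *s f' = (- a) *s e'" using that by (simp add: eq_neg_iff_add_eq_0)
    then show ?thesis using line[OF _ f'(2), of c] span_scale[OF span_base[of e' "{e'}"], of "- a"] by simp
  qed
  have modV1: "c = 0 \<and> d = 0" if cd: "c *s f + d *s f' \<in> V1" for c d
  proof -
    obtain a b where "c *s f + d *s f' = a *s e + b *s e'" using V1[OF cd] by blast
    then have "c *s f + (- a) *s e = (- d) *s f' + b *s e'" by (simp add: algebra_simps)
    then have "c *s f + (- a) *s e = 0" "(- d) *s f' + b *s e' = 0" using split by blast+
    then show ?thesis using lf[of c "- a"] lf'[of "- d" b] by simp
  qed
  have fL: "f \<in> L" "f' \<in> L" using f(1) f'(1) E(4,5) by auto
  obtain x where x: "x \<in> V1" "f - x \<in> V2" using bisec_decomp[OF V fL(1)] by metis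
  obtain y where y: "y \<in> V1" "f' - y \<in> V2" using bisec_decomp[OF V fL(2)] by metis
  obtain \<alpha> \<beta> where x_eq: "x = \<alpha> *s e + \<beta> *s e'" using V1[OF x(1)] by blast
  obtain \<gamma> \<delta> where y_eq: "y = \<gamma> *s e + \<delta> *s e'" using V1[OF y(1)] by blast
  \<comment> \<open>The coefficient matrix of s and t has determinant 1; the coefficients of e' in s and of e in t
    exceed those in x and y by 1.\<close>
  define B G where "B = \<beta> + 1" and "G = \<gamma> + 1"
  define s where "s = e + B *s e'"
  define t where "t = G *s e + (1 + B * G) *s e'"
  have s: "s \<in> V1" and t: "t \<in> V1"
    using subspace_add[OF D(2) e(1) subspace_scale[OF D(2) e'(1)]]
      subspace_add[OF D(2) subspace_scale[OF D(2) e(1)] subspace_scale[OF D(2) e'(1)]]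
    by (auto simp: s_def t_def)
  have st: "c = 0 \<and> d = 0" if "c *s s + d *s t = 0" for c d
  proof -
    have "c *s s + d *s t = (c + d * G) *s e + (c * B + d * (1 + B * G)) *s e'"
      by (simp add: s_def t_def scale_left_distrib scale_right_distrib algebra_simps)
    then have *: "c + d * G = 0" "c * B + d * (1 + B * G) = 0" using ee' that by metis+
    have "d = (c * B + d * (1 + B * G)) - (c + d * G) * B" by (simp add: algebra_simps)
    then have "d = 0" using * by simp
    then show ?thesis using * by simp
  qed
  have sx: "s - x \<notin> W1"
  proof
    assume *: "s - x \<in> W1"
    have "e' = (s - x) - (1 - \<alpha>) *s e"
      by (simp add: s_def x_eq B_def scale_left_distrib scale_left_diff_distrib)
    also have "\<dots> \<in> W1" using subspace_diff[OF E(2) * subspace_scale[OF E(2) e(2)]] .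
    finally show False using e' bisec_disjoint[OF W] by blast
  qed
  have ty: "t - y \<notin> W2"
  proof
    assume *: "t - y \<in> W2"
    have "e = (t - y) - (1 + B * G - \<delta>) *s e'"
      by (simp add: t_def y_eq G_def scale_left_distrib scale_left_diff_distrib)
    also have "\<dots> \<in> W2" using subspace_diff[OF E(3) * subspace_scale[OF E(3) e'(2)]] .
    finally show False using e bisec_disjoint[OF W] by blast
  qed
  define p where "p = f - x + s"
  define r where "r = f' - y + t"
  have decomp: "c *s p + d *s r = (c *s f + d *s f') + (c *s (s - x) + d *s (t - y))" for c d
    by (simp add: p_def r_def scale_right_distrib scale_right_diff_distrib algebra_simps)
  have sxty: "c *s (s - x) + d *s (t - y) \<in> V1" for c d
    using s t x(1) y(1) subspace_add[OF D(2)] subspace_scale[OF D(2)] subspace_diff[OF D(2)] by simp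
  have V1_pr: "c = 0 \<and> d = 0" if "c *s p + d *s r \<in> V1" for c d
  proof -
    have "c *s f + d *s f' = (c *s p + d *s r) - (c *s (s - x) + d *s (t - y))"
      by (simp add: decomp)
    also have "\<dots> \<in> V1" using subspace_diff[OF D(2) that sxty] .
    finally show ?thesis by (rule modV1)
  qed
  have V2_pr: "c = 0 \<and> d = 0" if "c *s p + d *s r \<in> V2" for c d
  proof -
    have "c *s s + d *s t = (c *s p + d *s r) - (c *s (f - x) + d *s (f' - y))"
      by (simp add: p_def r_def scale_right_distrib)
    also have "\<dots> \<in> V2" using subspace_diff[OF D(3) that
          subspace_add[OF D(3) subspace_scale[OF D(3) x(2)] subspace_scale[OF D(3) y(2)]]] .
    finally have "c *s s + d *s t \<in> V2" .
    moreover have "c *s s + d *s t \<in> V1"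
      using subspace_add[OF D(2) subspace_scale[OF D(2) s] subspace_scale[OF D(2) t]] .
    ultimately show ?thesis using st bisec_disjoint[OF V] by blast
  qed
  \<comment> \<open>A vector of \<open>W1\<close> has no \<open>W2\<close>-component, so
    \<open>d *s f' + b *s e'\<close> vanishes and \<open>d = 0\<close>. Then
    \<open>c *s (s - x)\<close> lies in \<open>W1\<close>, whereas \<open>s - x\<close> has
    coefficient 1 at \<open>e'\<close>.\<close>
  have W1_pr: "c = 0 \<and> d = 0" if "c *s p + d *s r \<in> W1" for c d
  proof -
    obtain a b where ab: "c *s (s - x) + d *s (t - y) = a *s e + b *s e'" using V1[OF sxty] by blast
    have "d *s f' + b *s e' = (c *s p + d *s r) - (c *s f + a *s e)"
      by (simp only: decomp ab) (simp add: algebra_simps)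
    also have "\<dots> \<in> W1" using subspace_diff[OF E(2) that
          subspace_add[OF E(2) subspace_scale[OF E(2) f(1)] subspace_scale[OF E(2) e(2)]]] .
    finally have "d *s f' + b *s e' \<in> W1" .
    moreover have "d *s f' + b *s e' \<in> W2"
      using subspace_add[OF E(3) subspace_scale[OF E(3) f'(1)] subspace_scale[OF E(3) e'(2)]] .
    ultimately have "d = 0" using lf' bisec_disjoint[OF W] by blast
    then have "c *s (s - x) = (c *s p + d *s r) - c *s f" unfolding decomp by simp
    also have "\<dots> \<in> W1" using subspace_diff[OF E(2) that subspace_scale[OF E(2) f(1)]] .
    finally have "c = 0" using sx mem_of_scale_mem[OF E(2)] by blast
    then show ?thesis using \<open>d = 0\<close> by simp
  qed
  have W2_pr: "c = 0 \<and> d = 0" if "c *s p + d *s r \<in> W2" for c d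
  proof -
    obtain a b where ab: "c *s (s - x) + d *s (t - y) = a *s e + b *s e'" using V1[OF sxty] by blast
    have "c *s f + a *s e = (c *s p + d *s r) - (d *s f' + b *s e')"
      by (simp only: decomp ab) (simp add: algebra_simps)
    also have "\<dots> \<in> W2" using subspace_diff[OF E(3) that
          subspace_add[OF E(3) subspace_scale[OF E(3) f'(1)] subspace_scale[OF E(3) e'(2)]]] .
    finally have "c *s f + a *s e \<in> W2" .
    moreover have "c *s f + a *s e \<in> W1"
      using subspace_add[OF E(2) subspace_scale[OF E(2) f(1)] subspace_scale[OF E(2) e(2)]] .
    ultimately have "c = 0" using lf bisec_disjoint[OF W] by blast
    then have "d *s (t - y) = (c *s p + d *s r) - d *s f'" unfolding decomp by simp
    also have "\<dots> \<in> W2" using subspace_diff[OF E(3) that subspace_scale[OF E(3) f'(1)]] .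
    finally have "d = 0" using ty mem_of_scale_mem[OF E(3)] by blast
    then show ?thesis using \<open>c = 0\<close> by simp
  qed
  have p0: "p \<noteq> 0" using V1_pr[of 1 0] D(14) by auto
  have rp: "r \<notin> span {p}"
  proof
    assume "r \<in> span {p}"
    then obtain c where "r = c *s p" by (auto simp: span_singleton)
    then show False using V1_pr[of "- c" 1] D(14) by simp
  qed
  have disj: "span {r, p} \<inter> A = {0}"
    if "0 \<in> A" "\<And>c d. c *s p + d *s r \<in> A \<Longrightarrow> c = 0 \<and> d = 0" for A
  proof -
    have "z = 0" if z: "z \<in> span {r, p}" "z \<in> A" for z
    proof -
      obtain d c where "z = d *s r + c *s p" using mem_span_two[OF z(1)] by blast
      then show ?thesis using z(2) \<open>\<And>c d. c *s p + d *s r \<in> A \<Longrightarrow> c = 0 \<and> d = 0\<close>[of c d]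
        by (simp add: add.commute)
    qed
    then show ?thesis using \<open>0 \<in> A\<close> span_zero by blast
  qed
  have "p \<in> L" "r \<in> L" unfolding p_def r_def
    using x(2) y(2) s t D(4,5) subspace_add[OF D(1)] by blast+
  then have "span {r, p} \<subseteq> L" using span_minimal[of "{r, p}" L] D(1) by simp
  then show ?thesis unfolding common_compl_def
    using card_span_two[OF p0 rp] disj[OF D(14) V1_pr] disj[OF D(15) V2_pr]
      disj[OF E(14) W1_pr] disj[OF E(15) W2_pr]
    by (intro exI[of _ "span {r, p}"]) simp
qed

section \<open>Dimension six over the field with two elements\<close>

lemma scalar_cases:
  assumes "CARD('f) = 2"
  shows "c = 0 \<or> c = (1 :: 'f)"
proof -
  have "{0, 1 :: 'f} = UNIV" by (rule card_subset_eq) (use assms in auto)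
  then show ?thesis by blast
qed

lemma card_span_le:
  assumes "finite S"
  shows "finite (span S) \<and> card (span S) \<le> CARD('f) ^ card S"
  using assms
proof (induction S)
  case (insert x S)
  have *: "span (insert x S) = span (insert x (span S))" by (simp only: span_insert_span)
  show ?case
  proof (cases "x \<in> span S")
    case True
    then have "span (insert x S) = span S" by (rule span_redundant)
    moreover have "CARD('f) ^ card S \<le> CARD('f) ^ card (insert x S)"
      using card_field_ge_2 insert.hyps by (intro power_increasing) auto
    ultimately show ?thesis using insert.IH by auto
  next
    case False
    then have "card (span (insert x S)) = CARD('f) * card (span S)"
      unfolding * by (rule card_span_insert[OF subspace_span])
    moreover have "0 < card (span S)" using insert.IH span_zero[of S] by (auto simp: card_gt_0_iff)
    ultimately show ?thesis using insert.IH insert.hyps by (auto intro: card_ge_0_finite)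
  qed
qed simp

lemma card_span_insert_le:
  assumes "subspace A" "finite A"
  shows "card (span (insert u A)) \<le> CARD('f) * card A"
proof (cases "u \<in> A")
  case True
  then have "span (insert u A) = A" using assms(1) by (simp add: insert_absorb span_eq_iff)
  then show ?thesis using card_field_ge_2 by simp
qed (simp add: card_span_insert assms(1))

text \<open>A vector outside all the subspaces exists by counting, and the shared component remains
  shared in the quotient, where \<open>common_compl_2_shared\<close> applies.\<close>

lemma common_compl_3_shared:
  assumes "CARD('f) = 2" and V: "bisec 3 L A V" and W: "bisec 3 L A W"
  shows "common_compl 3 L {A, V, A, W}"
proof -
  note D = bisecD[OF V] and E = bisecD[OF W]
  have "card A + card V + card W + card {0 :: 'v} < card L + 3 * card {0 :: 'v}"
    using D(7-9) E(9) assms(1) by simp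
  then obtain u where u: "u \<in> L" "u \<notin> A" "u \<notin> V" "u \<notin> W" "u \<notin> {0}"
    by (rule not_union_four[where Z = "{0}"]) (use D(11,12,14,15) E(12,15) in simp_all)
  obtain C where C: "bisec 2 C (red u C A) (red u C V)" "bisec 2 C (red u C A) (red u C W)"
    "common_compl 2 C {red u C A, red u C V, red u C A, red u C W} \<Longrightarrow>
       common_compl 3 L {A, V, A, W}"
    using reduction_point[of 2 L A V A W u] V W u by (metis Suc_1 eval_nat_numeral(3))
  then show ?thesis using common_compl_2_shared[OF assms(1)] by blast
qed

text \<open>Modulo \<open>u\<close> the vectors \<open>a\<close> and \<open>b\<close> put
  \<open>V1\<close> in contact with \<open>W1\<close> and with \<open>W2\<close>, so the quotient is
  settled by \<open>common_compl_2_cross\<close>. The remaining cases without a shared component are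
  brought into this form.\<close>

lemma common_compl_3_reduce:
  assumes V: "bisec 3 L V1 V2" and W: "bisec 3 L W1 W2"
    and K: "subspace K" "K \<subseteq> L" "u \<in> K"
    and v: "v \<in> V1" "u - v \<in> V2" "v \<notin> K"
    and w: "w \<in> W1" "u - w \<in> W2" "w \<notin> K"
    and a: "a \<in> K" "a \<in> V1" "a \<noteq> 0" "a + c *s u \<in> W1"
    and b: "b \<in> K" "b \<in> V1" "b \<noteq> 0" "b + d *s u \<in> W2"
  shows "common_compl 3 L {V1, V2, W1, W2}"
proof -
  obtain C where C: "bisec 2 C (red u C V1) (red u C V2)" "bisec 2 C (red u C W1) (red u C W2)"
    "K \<subseteq> span (insert u C)" "subspace C" "u \<notin> V1"
    "common_compl 2 C {red u C V1, red u C V2, red u C W1, red u C W2} \<Longrightarrow>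
       common_compl 3 L {V1, V2, W1, W2}"
    using reduction[of 2 L V1 V2 W1 W2, OF _ _ K v w] V W by (metis Suc_1 eval_nat_numeral(3))
  have ab: "a \<in> span (insert u C)" "b \<in> span (insert u C)" using C(3) a(1) b(1) by auto
  obtain x where x: "x \<in> red u C V1" "x \<in> red u C W1" "x \<noteq> 0"
    using red_meet[OF C(4) bisecD(2)[OF V] C(5) ab(1) a(2,3,4)] by metis
  obtain y where y: "y \<in> red u C V1" "y \<in> red u C W2" "y \<noteq> 0"
    using red_meet[OF C(4) bisecD(2)[OF V] C(5) ab(2) b(2,3,4)] by metis
  show ?thesis using C(6) common_compl_2_cross[OF C(1,2) x y] by blast
qed

text \<open>The position is already the desired one, so \<open>e\<close> and \<open>e'\<close> only
  have to be kept inside the hyperplane. The four sets that \<open>u\<close> avoids are those that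
  could put a component of \<open>u\<close> into \<open>span {u, e, e'}\<close>.\<close>

lemma common_compl_3_cross:
  assumes q: "CARD('f) = 2" and V: "bisec 3 L V1 V2" and W: "bisec 3 L W1 W2"
    and e: "e \<in> V1" "e \<in> W1" "e \<noteq> 0" and e': "e' \<in> V1" "e' \<in> W2" "e' \<noteq> 0"
  shows "common_compl 3 L {V1, V2, W1, W2}"
proof -
  note D = bisecD[OF V] and E = bisecD[OF W]
  have eL: "e \<in> L" "e' \<in> L" using e(1) e'(1) D(4) by auto
  have e'e: "e' \<notin> span {e}"
  proof
    assume "e' \<in> span {e}"
    then obtain c where "e' = c *s e" by (auto simp: span_singleton)
    then have "e' \<in> W1" using subspace_scale[OF E(2) e(2)] by simp
    then show False using e' bisec_disjoint[OF W] by blast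
  qed
  let ?Z = "span {e', e}" and ?M = "span (insert e' V2)"
  let ?A = "span (insert e ?M)" and ?B = "span (insert e W2)" and ?C = "span (insert e' W1)"
  have A0: "?M \<subseteq> L" using span_insert_least[OF D(1,5) eL(2)] .
  have sub: "?A \<subseteq> L" "?B \<subseteq> L" "?C \<subseteq> L"
    by (fact span_insert_least[OF D(1) A0 eL(1)] span_insert_least[OF D(1) E(5) eL(1)]
      span_insert_least[OF D(1) E(4) eL(2)])+
  have fin: "finite ?M" "finite ?A" "finite ?B" "finite ?C"
    using sub A0 D(10) finite_subset by metis+
  \<comment> \<open>The common part \<open>?Z\<close> is essential here: the sizes are at most 32 +
    8 + 16 + 16 = 72, which exceeds 64 + 3 but not 64 + 3 * 4.\<close>
  have "card ?A + card V1 + card ?B + card ?C < card L + 3 * card ?Z"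
    using card_span_insert_le[OF D(3,12), of e'] card_span_insert_le[OF subspace_span fin(1), of e]
      card_span_insert_le[OF E(3,12), of e] card_span_insert_le[OF E(2,11), of e']
      card_span_two[OF e(3) e'e] D(7-9) E(8,9) by (simp add: q)
  moreover have "e' \<in> ?A" "e \<in> ?A" "e' \<in> ?B" "e \<in> ?B" "e' \<in> ?C" "e \<in> ?C"
    using span_insert_mem[of e' V2] e(2) e'(2) by (auto intro: span_base)
  then have "?Z \<subseteq> ?A" "?Z \<subseteq> V1" "?Z \<subseteq> ?B" "?Z \<subseteq> ?C"
    using e(1) e'(1) D(2) by (simp_all add: span_minimal)
  ultimately obtain u where u: "u \<in> L" "u \<notin> ?A" "u \<notin> V1" "u \<notin> ?B" "u \<notin> ?C"
    using not_union_four[OF _ fin(2) D(11) fin(3,4)] by metis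
  obtain v where v: "v \<in> V1" "u - v \<in> V2" using bisec_decomp[OF V u(1)] by metis
  obtain w where w: "w \<in> W1" "u - w \<in> W2" using bisec_decomp[OF W u(1)] by metis
  let ?K = "span {u, e, e'}"
  have K: "?K \<subseteq> L" "u \<in> ?K" "e \<in> ?K" "e' \<in> ?K"
    using span_minimal[of "{u, e, e'}" L] u(1) eL D(1) by (auto intro: span_base)
  have v': "v \<notin> ?K"
  proof
    assume "v \<in> ?K"
    then obtain c d g where c: "v = c *s u + d *s e + g *s e'" using mem_span_three by blast
    then have "v - d *s e - g *s e' = c *s u" by simp
    moreover have "v - d *s e - g *s e' \<in> V1"
      using v(1) e(1) e'(1) subspace_diff[OF D(2)] subspace_scale[OF D(2)] by simp
    ultimately have "c = 0" using u(3) mem_of_scale_mem[OF D(2), of c u] by metis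
    then have "u - d *s e - g *s e' \<in> V2" using v(2) c by (simp add: algebra_simps)
    then have "u - d *s e \<in> ?M" by (rule span_insertI[OF D(3)])
    then have "u \<in> ?A" by (rule span_insertI[OF subspace_span])
    then show False using u(2) by blast
  qed
  have w': "w \<notin> ?K"
  proof
    assume "w \<in> ?K"
    then obtain c d g where c: "w = c *s u + d *s e + g *s e'" using mem_span_three by blast
    consider "c = 0" | "c = 1" using scalar_cases[OF q] by blast
    then show False
    proof cases
      case 1
      then have "w - d *s e = g *s e'" using c by simp
      moreover have "w - d *s e \<in> W1" using subspace_diff[OF E(2) w(1) subspace_scale[OF E(2) e(2)]] .
      moreover have "g *s e' \<in> W2" using subspace_scale[OF E(3) e'(2)] .
      ultimately have "w - d *s e = 0" using bisec_disjoint[OF W] by metis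
      then have "u - d *s e \<in> W2" using w(2) by simp
      then show False using span_insertI[OF E(3)] u(4) by blast
    next
      case 2
      then have "(u - w) + g *s e' = (- d) *s e" using c by simp
      moreover have "(u - w) + g *s e' \<in> W2"
        using subspace_add[OF E(3) w(2) subspace_scale[OF E(3) e'(2)]] .
      moreover have "(- d) *s e \<in> W1" using subspace_scale[OF E(2) e(2)] .
      ultimately have "(u - w) + g *s e' = 0" using bisec_disjoint[OF W] by metis
      then have "u - (- g) *s e' = w" by (simp add: algebra_simps)
      then show False using span_insertI[OF E(2)] u(5) w(1) by blast
    qed
  qed
  have "e + 0 *s u \<in> W1" "e' + 0 *s u \<in> W2" using e(2) e'(2) by simp_all
  then show ?thesis
    using common_compl_3_reduce[OF V W subspace_span K(1,2) v v' w w' K(3) e(1,3) _ K(4) e'(1,3)]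
    by blast
qed

text \<open>Now \<open>V1\<close> is complementary to \<open>W1\<close> and to \<open>W2\<close>. A
  vector \<open>h\<close> of \<open>V2\<close> outside both therefore has nonzero
  \<open>V1\<close>-components \<open>x\<close> along \<open>W1\<close> and \<open>y\<close> along
  \<open>W2\<close>. A vector \<open>p\<close> of \<open>V1\<close> outside their span is added to
  \<open>h\<close> so that the shifted vectors \<open>p + x\<close> and \<open>p + y\<close> can go
  into the hyperplane while the component \<open>p\<close> of \<open>u\<close> stays out.\<close>

lemma common_compl_3_disjoint:
  assumes q: "CARD('f) = 2" and V: "bisec 3 L V1 V2" and W: "bisec 3 L W1 W2"
    and VW1: "\<And>x. x \<in> V1 \<Longrightarrow> x \<in> W1 \<Longrightarrow> x = 0" and VW2: "\<And>x. x \<in> V1 \<Longrightarrow> x \<in> W2 \<Longrightarrow> x = 0"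
    and ne: "V2 \<noteq> W1" "V2 \<noteq> W2"
  shows "common_compl 3 L {V1, V2, W1, W2}"
proof -
  note D = bisecD[OF V] and E = bisecD[OF W]
  have "V1 \<inter> W1 = {0}" "V1 \<inter> W2 = {0}" using VW1 VW2 D(14) E(14,15) by blast+
  then have B1: "bisec 3 L V1 W1" and B2: "bisec 3 L V1 W2" using V W by (simp_all add: bisec_def)
  have "\<not> V2 \<subseteq> W1" "\<not> V2 \<subseteq> W2"
    using card_subset_eq[OF E(11), of V2] card_subset_eq[OF E(12), of V2] D(9) E(8,9) ne by auto
  then obtain h where h: "h \<in> V2" "h \<notin> W1" "h \<notin> W2"
    by (rule not_union_two_proper[OF D(3) E(2,3)])
  have h0: "h \<noteq> 0" using h(2) E(14) by auto
  have hL: "h \<in> L" using h(1) D(5) by blast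
  obtain x where x: "x \<in> V1" "h - x \<in> W1" using bisec_decomp[OF B1 hL] by metis
  obtain y where y: "y \<in> V1" "h - y \<in> W2" using bisec_decomp[OF B2 hL] by metis
  have x0: "x \<noteq> 0" "y \<noteq> 0" using x(2) y(2) h(2,3) by auto
  have "card (span {x, y}) \<le> CARD('f) ^ card {x, y}" using card_span_le[of "{x, y}"] by simp
  also have "\<dots> \<le> CARD('f) ^ 2" using q by (intro power_increasing) (auto simp: card_insert_if)
  finally have "\<not> V1 \<subseteq> span {x, y}"
    using card_mono[of "span {x, y}" V1] card_span_le[of "{x, y}"] D(8) q by auto
  then obtain p where p: "p \<in> V1" "p \<notin> span {x, y}" by blast
  have pspan: False if "p = c *s x + d *s y" for c d
  proof -
    have "c *s x + d *s y \<in> span {x, y}" by (intro span_add span_scale span_base) auto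
    then show False using p(2) that by simp
  qed
  have p0: "p \<noteq> 0" using pspan[of 0 0] by auto
  have pL: "p \<in> L" "x \<in> L" "y \<in> L" using p(1) x(1) y(1) D(4) by auto
  have px: "p + x \<in> V1" "p + y \<in> V1" using p(1) x(1) y(1) subspace_add[OF D(2)] by auto
  have px0: "p + x \<noteq> 0" "p + y \<noteq> 0"
    using pspan[of "-1" 0] pspan[of 0 "-1"] by (auto simp: eq_neg_iff_add_eq_0)
  \<comment> \<open>Modulo u, the vectors p + x and p + y of V1 lie in W1 and in W2, so after the reduction
    V1 meets both W1 and W2.\<close>
  define u where "u = p + h"
  let ?K = "span {u, p + x, p + y}"
  have uL: "u \<in> L" using pL(1) hL subspace_add[OF D(1)] by (simp add: u_def)
  have K: "?K \<subseteq> L" "u \<in> ?K" "p + x \<in> ?K" "p + y \<in> ?K"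
    using span_minimal[of "{u, p + x, p + y}" L] uL pL D(1) subspace_add[OF D(1)]
    by (auto intro: span_base)
  have uW: "u - (p + x) \<in> W1" "u - (p + y) \<in> W2" using x(2) y(2) by (simp_all add: u_def)
  have v: "u - p \<in> V2" using h(1) by (simp add: u_def)
  have v': "p \<notin> ?K"
  proof
    assume "p \<in> ?K"
    then obtain c d g where c: "p = c *s u + d *s (p + x) + g *s (p + y)"
      using mem_span_three by blast
    define z where "z = d *s (p + x) + g *s (p + y)"
    have z: "p = c *s (p + h) + z" using c by (simp add: z_def u_def add.assoc)
    have zV: "z \<in> V1" unfolding z_def
      using subspace_add[OF D(2) subspace_scale[OF D(2) px(1)] subspace_scale[OF D(2) px(2)]] .
    have "c *s h = p - c *s p - z" using z by (simp add: scale_right_distrib algebra_simps)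
    moreover have "p - c *s p - z \<in> V1"
      using p(1) zV subspace_diff[OF D(2)] subspace_scale[OF D(2)] by simp
    moreover have "c *s h \<in> V2" using subspace_scale[OF D(3) h(1)] .
    ultimately have "c *s h = 0" using bisec_disjoint[OF V] by metis
    then have "c = 0" using h0 by simp
    then have pz: "p = d *s (p + x) + g *s (p + y)" using z by (simp add: z_def)
    consider "d = 0" "g = 0" | "d = 1" "g = 0" | "d = 0" "g = 1" | "d = 1" "g = 1"
      using scalar_cases[OF q] by blast
    then show False
    proof cases
      case 4
      then have "p = (p + x) + (p + y)" using pz by simp
      then have "0 = p + (x + y)" by (simp add: algebra_simps)
      then have "p = (-1) *s x + (-1) *s y" by (simp add: eq_neg_iff_add_eq_0 algebra_simps)
      then show False by (rule pspan)
    qed (use pz p0 x0 in auto)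
  qed
  obtain w where w: "w \<in> W1" "u - w \<in> W2" using bisec_decomp[OF W uL] by metis
  have w': "w \<notin> ?K"
  proof
    assume wK: "w \<in> ?K"
    have uwK: "u - w \<in> ?K" "u - (p + x) \<in> ?K" "u - (p + y) \<in> ?K"
      using wK K(2-4) span_diff by auto
    have ne0: "u - (p + x) \<noteq> 0" "u - (p + y) \<noteq> 0"
      using bisec_disjoint[OF V x(1)] bisec_disjoint[OF V y(1)] h(1) x0 by (auto simp: u_def)
    have w1: "w \<notin> span {u - (p + x)}"
    proof
      assume "w \<in> span {u - (p + x)}"
      then obtain c where c: "w = c *s (u - (p + x))" by (auto simp: span_singleton)
      consider "c = 0" | "c = 1" using scalar_cases[OF q] by blast
      then show False
      proof cases
        case 1
        then have "u \<in> W2" using c w(2) by simp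
        then have "u - (u - (p + y)) \<in> W2" using subspace_diff[OF E(3) _ uW(2)] by blast
        then have "p + y \<in> W2" by (simp add: add.commute)
        then show False using VW2 px px0 by blast
      next
        case 2
        then have "p + x \<in> W2" using c w(2) by (simp add: add.commute)
        then show False using VW2 px px0 by blast
      qed
    qed
    have w2: "u - w \<notin> span {u - (p + y)}"
    proof
      assume "u - w \<in> span {u - (p + y)}"
      then obtain c where c: "u - w = c *s (u - (p + y))" by (auto simp: span_singleton)
      consider "c = 0" | "c = 1" using scalar_cases[OF q] by blast
      then show False
      proof cases
        case 1
        then have "u \<in> W1" using c w(1) by simp
        then have "u - (u - (p + x)) \<in> W1" using subspace_diff[OF E(2) _ uW(1)] by blast
        then have "p + x \<in> W1" by (simp add: add.commute)
        then show False using VW1 px px0 by blast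
      next
        case 2
        then have "w = p + y" using c by (simp add: algebra_simps)
        then show False using VW1 px px0 w(1) by blast
      qed
    qed
    \<comment> \<open>These are planes inside \<open>W1\<close> and inside \<open>W2\<close>, so
      their direct sum has 16 elements; three vectors span at most 8.\<close>
    let ?S = "span {w, u - (p + x)}" and ?T = "span {u - w, u - (p + y)}"
    have S: "?S \<subseteq> ?K" "?T \<subseteq> ?K" using wK uwK by (simp_all add: span_minimal)
    have "?S \<subseteq> W1" "?T \<subseteq> W2" using w uW E(2,3) by (simp_all add: span_minimal)
    then have "?S \<inter> ?T = {0}" using E(6) span_zero by blast
    moreover have fK: "finite ?K" using K(1) D(10) finite_subset by blast
    ultimately have "card ?S * card ?T \<le> card ?K"
      using card_direct_sum_le(1)[OF subspace_span subspace_span subspace_span S] by blast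
    moreover have "card ?S = 4" "card ?T = 4"
      using card_span_two[OF ne0(1) w1] card_span_two[OF ne0(2) w2] q by simp_all
    moreover have "card ?K \<le> CARD('f) ^ card {u, p + x, p + y}"
      using card_span_le[of "{u, p + x, p + y}"] by simp
    moreover have "CARD('f) ^ card {u, p + x, p + y} \<le> CARD('f) ^ 3"
      using q by (intro power_increasing) (auto simp: card_insert_if)
    ultimately show False using q by simp
  qed
  have "p + x + (-1) *s u = - (u - (p + x))" "p + y + (-1) *s u = - (u - (p + y))" by simp_all
  then have "p + x + (-1) *s u \<in> W1" "p + y + (-1) *s u \<in> W2"
    using subspace_neg[OF E(2) uW(1)] subspace_neg[OF E(3) uW(2)] by metis+
  then show ?thesis
    using common_compl_3_reduce[OF V W subspace_span K(1,2) p(1) v v' w w' K(3) px(1) px0(1) _ K(4) px(2) px0(2)]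
    by blast
qed

text \<open>Addition maps a set with \<open>card L\<close> elements onto a set covering
  \<open>L\<close>, so it is injective; a common vector \<open>x\<close> would be the sum of both
  \<open>(x, 0)\<close> and \<open>(0, x)\<close>.\<close>

lemma trivial_inter_of_sum:
  assumes "subspace A" "subspace B" "finite A" "finite B" "card L = card A * card B"
    and "L \<subseteq> {x + y | x y. x \<in> A \<and> y \<in> B}"
  shows "A \<inter> B = {0}"
proof -
  let ?f = "\<lambda>(x, y). x + y"
  have fin: "finite (A \<times> B)" using assms(3,4) by simp
  have "L \<subseteq> ?f ` (A \<times> B)" using assms(6) by (auto simp: image_iff)
  then have "card L \<le> card (?f ` (A \<times> B))" using fin by (intro card_mono) auto
  moreover have "card (?f ` (A \<times> B)) \<le> card (A \<times> B)" using fin by (rule card_image_le)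
  ultimately have inj: "inj_on ?f (A \<times> B)"
    using fin assms(5) by (intro eq_card_imp_inj_on) (simp_all add: card_cartesian_product)
  have "x = 0" if x: "x \<in> A" "x \<in> B" for x
  proof -
    have "(x, 0) \<in> A \<times> B" "(0, x) \<in> A \<times> B"
      using x subspace_0[OF assms(1)] subspace_0[OF assms(2)] by auto
    moreover have "?f (x, 0) = ?f (0, x)" by simp
    ultimately have "(x, 0) = (0, x)" using inj by (meson inj_onD)
    then show ?thesis by simp
  qed
  then show ?thesis using subspace_0[OF assms(1)] subspace_0[OF assms(2)] by blast
qed

text \<open>The meeting of \<open>V1\<close> and \<open>W1\<close> is preserved and one of
  \<open>V1\<close> and \<open>W2\<close> is created by \<open>u = a + b\<close>. To keep the
  components of \<open>u\<close> out of \<open>span {a, b, e}\<close>, \<open>b\<close> avoids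
  \<open>span (insert e V2)\<close>, which \<open>nsub\<close> permits, and the sum of
  \<open>V1\<close> and \<open>W1\<close>; \<open>a\<close> avoids \<open>W1\<close> and the span of
  \<open>e\<close> and the \<open>V1\<close>-component of \<open>b\<close>.\<close>

lemma common_compl_3_mixed:
  assumes q: "CARD('f) = 2" and V: "bisec 3 L V1 V2" and W: "bisec 3 L W1 W2"
    and e: "e \<in> V1" "e \<in> W1" "e \<noteq> 0" and VW2: "\<And>x. x \<in> V1 \<Longrightarrow> x \<in> W2 \<Longrightarrow> x = 0"
    and ne: "V1 \<noteq> W1" and nsub: "\<not> W2 \<subseteq> span (insert e V2)"
  shows "common_compl 3 L {V1, V2, W1, W2}"
proof -
  note D = bisecD[OF V] and E = bisecD[OF W]
  let ?X = "{x + y | x y. x \<in> V1 \<and> y \<in> W1}"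
  have X: "subspace ?X" using subspace_sums[OF D(2) E(2)] .
  have XI: "x + y \<in> ?X" if "x \<in> V1" "y \<in> W1" for x y using that by blast
  \<comment> \<open>Otherwise \<open>?X\<close> contains both components of the second bisection,
    hence \<open>L\<close>, and the dimensions leave no room for the common vector
    \<open>e\<close>.\<close>
  have "\<not> W2 \<subseteq> ?X"
  proof
    assume sub: "W2 \<subseteq> ?X"
    have "L \<subseteq> ?X"
    proof
      fix z assume "z \<in> L"
      then obtain y where y: "y \<in> W1" "z - y \<in> W2" using bisec_decomp[OF W] by metis
      then obtain x y' where xy: "x \<in> V1" "y' \<in> W1" "z - y = x + y'" using sub by blast
      then have "z = x + (y' + y)" by (simp add: algebra_simps)
      then show "z \<in> ?X" using XI[OF xy(1) subspace_add[OF E(2) xy(2) y(1)]] by simp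
    qed
    moreover have "card L = card V1 * card W1" using D(7,8) E(8) by (simp add: power_add[symmetric])
    ultimately have "V1 \<inter> W1 = {0}" by (intro trivial_inter_of_sum[OF D(2) E(2) D(11) E(11)])
    then show False using e by blast
  qed
  then obtain b where b: "b \<in> W2" "b \<notin> span (insert e V2)" "b \<notin> ?X"
    by (rule not_union_two_proper[OF E(3) subspace_span X nsub])
  have b0: "b \<noteq> 0" using b(2) span_zero by auto
  have bL: "b \<in> L" and eL: "e \<in> L" using b(1) E(5) e(1) D(4) by auto
  obtain b1 where b1: "b1 \<in> V1" "b - b1 \<in> V2" using bisec_decomp[OF V bL] by metis
  have "card (span {e, b1}) \<le> CARD('f) ^ card {e, b1}" using card_span_le[of "{e, b1}"] by simp
  also have "\<dots> \<le> CARD('f) ^ 2" using q by (intro power_increasing) (auto simp: card_insert_if)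
  finally have "\<not> V1 \<subseteq> span {e, b1}"
    using card_mono[of "span {e, b1}" V1] card_span_le[of "{e, b1}"] D(8) q by auto
  moreover have "\<not> V1 \<subseteq> W1" using card_subset_eq[OF E(11), of V1] D(8) E(8) ne by auto
  ultimately obtain a where a: "a \<in> V1" "a \<notin> span {e, b1}" "a \<notin> W1"
    using not_union_two_proper[OF D(2) subspace_span E(2)] by metis
  have a0: "a \<noteq> 0" using a(3) E(14) by auto
  have aL: "a \<in> L" using a(1) D(4) by blast
  obtain w where w: "w \<in> W1" "a - w \<in> W2" using bisec_decomp[OF W aL] by metis
  \<comment> \<open>After the reduction V1 still meets W1 in e, and it meets W2 because a = - b modulo u.\<close>
  define u where "u = a + b"
  let ?K = "span {a, b, e}"
  have K: "?K \<subseteq> L" "a \<in> ?K" "b \<in> ?K" "e \<in> ?K"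
    using span_minimal[of "{a, b, e}" L] aL bL eL D(1) by (auto intro: span_base)
  have uK: "u \<in> ?K" unfolding u_def using span_add[OF K(2,3)] .
  have v: "a + b1 \<in> V1" "u - (a + b1) \<in> V2"
    using subspace_add[OF D(2) a(1) b1(1)] b1(2) by (simp_all add: u_def)
  have v': "a + b1 \<notin> ?K"
  proof
    assume "a + b1 \<in> ?K"
    then obtain c d g where c: "a + b1 = c *s a + d *s b + g *s e" using mem_span_three by blast
    then have "a + b1 - c *s a - g *s e = d *s b" by simp
    moreover have "a + b1 - c *s a - g *s e \<in> V1"
      using v(1) a(1) e(1) subspace_diff[OF D(2)] subspace_scale[OF D(2)] by simp
    moreover have "d *s b \<in> W2" using subspace_scale[OF E(3) b(1)] .
    ultimately have "d *s b = 0" using VW2 by metis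
    then have d: "a + b1 = c *s a + g *s e" using c by simp
    consider "c = 0" | "c = 1" using scalar_cases[OF q] by blast
    then show False
    proof cases
      case 1
      then have "a = g *s e + (-1) *s b1" using d by (simp add: algebra_simps)
      moreover have "g *s e + (-1) *s b1 \<in> span {e, b1}"
        by (intro span_add span_scale span_base) auto
      ultimately show False using a(2) by metis
    next
      case 2
      then have "b1 = g *s e" using d by simp
      then show False using span_insertI[OF D(3), of b g e] b1(2) b(2) by simp
    qed
  qed
  have w2: "u - w \<in> W2" using subspace_add[OF E(3) w(2) b(1)] by (simp add: u_def algebra_simps)
  have w': "w \<notin> ?K"
  proof
    assume "w \<in> ?K"
    then obtain c d g where c: "w = c *s a + d *s b + g *s e" using mem_span_three by blast
    then have "w - c *s w - g *s e = c *s (a - w) + d *s b"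
      by (simp add: scale_right_diff_distrib algebra_simps)
    moreover have "w - c *s w - g *s e \<in> W1"
      using w(1) e(2) subspace_diff[OF E(2)] subspace_scale[OF E(2)] by simp
    moreover have "c *s (a - w) + d *s b \<in> W2"
      using subspace_add[OF E(3) subspace_scale[OF E(3) w(2)] subspace_scale[OF E(3) b(1)]] .
    ultimately have 0: "w - c *s w - g *s e = 0" "c *s (a - w) + d *s b = 0"
      using bisec_disjoint[OF W] by metis+
    consider "c = 0" | "c = 1" "d = 0" | "c = 1" "d = 1" using scalar_cases[OF q] by blast
    then show False
    proof cases
      case 1
      then have "w = g *s e" using 0(1) by simp
      then have "w \<in> V1" using subspace_scale[OF D(2) e(1)] by simp
      then have "a - w = 0" using VW2 w(2) subspace_diff[OF D(2) a(1)] by blast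
      then show False using w(1) a(3) by simp
    next
      case 2
      then have "a = w" using 0(2) by simp
      then show False using w(1) a(3) by simp
    next
      case 3
      then have "b = (- a) + w" using 0(2) by (simp add: algebra_simps)
      then show False using XI[OF subspace_neg[OF D(2) a(1)] w(1)] b(3) by simp
    qed
  qed
  have "a + (-1) *s u \<in> W2" using subspace_neg[OF E(3) b(1)] by (simp add: u_def)
  moreover have "e + 0 *s u \<in> W1" using e(2) by simp
  ultimately show ?thesis
    using common_compl_3_reduce[OF V W subspace_span K(1) uK v v' w(1) w2 w' K(4) e(1,3) _ K(2) a(1) a0]
    by blast
qed

text \<open>\<open>common_compl_3_mixed\<close> can be tried with every nonzero \<open>x\<close> in
  \<open>V1 \<inter> W1\<close>, and with \<open>f\<close> after swapping the components of both
  bisections. If its span condition fails each time, \<open>W1\<close> lies in the span of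
  \<open>f\<close> and \<open>V1\<close>, so \<open>V1 \<inter> W1\<close> has dimension at least
  two. Then \<open>W2\<close> lies in \<open>span (insert x V2)\<close> for two independent
  \<open>x\<close>, hence in \<open>V2\<close>, which contradicts
  \<open>V2 \<noteq> W2\<close>.\<close>

lemma common_compl_3_diagonal:
  assumes q: "CARD('f) = 2" and V: "bisec 3 L V1 V2" and W: "bisec 3 L W1 W2"
    and e: "e \<in> V1" "e \<in> W1" "e \<noteq> 0" and f: "f \<in> V2" "f \<in> W2" "f \<noteq> 0"
    and V1W2: "\<And>x. x \<in> V1 \<Longrightarrow> x \<in> W2 \<Longrightarrow> x = 0" and V2W1: "\<And>x. x \<in> V2 \<Longrightarrow> x \<in> W1 \<Longrightarrow> x = 0"
    and ne: "V1 \<noteq> W1" "V2 \<noteq> W2"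
  shows "common_compl 3 L {V1, V2, W1, W2}"
proof -
  note D = bisecD[OF V] and E = bisecD[OF W]
  consider x where "x \<in> V1" "x \<in> W1" "x \<noteq> 0" "\<not> W2 \<subseteq> span (insert x V2)"
    | "\<not> W1 \<subseteq> span (insert f V1)"
    | "\<And>x. x \<in> V1 \<Longrightarrow> x \<in> W1 \<Longrightarrow> x \<noteq> 0 \<Longrightarrow> W2 \<subseteq> span (insert x V2)" "W1 \<subseteq> span (insert f V1)"
    by blast
  then show ?thesis
  proof cases
    case 1
    then show ?thesis using common_compl_3_mixed[OF q V W 1(1-3) V1W2 ne(1)] by blast
  next
    case 2
    then have "common_compl 3 L {V2, V1, W2, W1}"
      using common_compl_3_mixed[OF q bisec_commute[OF V] bisec_commute[OF W] f V2W1 ne(2)] by blast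
    then show ?thesis by (metis insert_commute)
  next
    case 3
    have "\<not> W1 \<subseteq> V1" using card_subset_eq[OF D(11), of W1] D(8) E(8) ne(1) by auto
    then obtain w where w: "w \<in> W1" "w \<notin> V1" by blast
    obtain c where c: "w - c *s f \<in> V1" using span_insertE[OF subsetD[OF 3(2) w(1)] D(2)] by metis
    have c0: "c \<noteq> 0" using c w(2) by auto
    have "card (span {e, w}) \<le> CARD('f) ^ card {e, w}" using card_span_le[of "{e, w}"] by simp
    also have "\<dots> \<le> CARD('f) ^ 2" using q by (intro power_increasing) (auto simp: card_insert_if)
    finally have "\<not> W1 \<subseteq> span {e, w}"
      using card_mono[of "span {e, w}" W1] card_span_le[of "{e, w}"] E(8) q by auto
    then obtain x where x: "x \<in> W1" "x \<notin> span {e, w}" by blast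
    obtain d where d: "x - d *s f \<in> V1" using span_insertE[OF subsetD[OF 3(2) x(1)] D(2)] by metis
    \<comment> \<open>Modulo \<open>V1\<close>, \<open>w\<close> and \<open>x\<close> are multiples
      of \<open>f\<close>. This combination cancels \<open>f\<close>, so it lies in
      \<open>V1 \<inter> W1\<close>, and \<open>x \<notin> span {e, w}\<close> makes it independent
      of \<open>e\<close>.\<close>
    define e2 where "e2 = x - (d / c) *s w"
    have "e2 = (x - d *s f) - (d / c) *s (w - c *s f)"
      using c0 by (simp add: e2_def scale_right_diff_distrib)
    also have "\<dots> \<in> V1" using subspace_diff[OF D(2) d subspace_scale[OF D(2) c]] .
    finally have e2V: "e2 \<in> V1" .
    have e2W: "e2 \<in> W1" unfolding e2_def
      using subspace_diff[OF E(2) x(1) subspace_scale[OF E(2) w(1)]] .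
    have e2: "e2 \<noteq> g *s e" for g
    proof
      assume "e2 = g *s e"
      then have "x = g *s e + (d / c) *s w" by (simp add: e2_def algebra_simps)
      moreover have "g *s e + (d / c) *s w \<in> span {e, w}"
        by (intro span_add span_scale span_base) auto
      ultimately show False using x(2) by metis
    qed
    have e20: "e2 \<noteq> 0" using e2[of 0] by simp
    have "W2 \<subseteq> V2"
    proof
      fix z assume z: "z \<in> W2"
      obtain g where g: "z - g *s e \<in> V2"
        using span_insertE[OF subsetD[OF 3(1)[OF e] z] D(3)] by metis
      obtain h where h: "z - h *s e2 \<in> V2"
        using span_insertE[OF subsetD[OF 3(1)[OF e2V e2W e20] z] D(3)] by metis
      have "h *s e2 - g *s e = (z - g *s e) - (z - h *s e2)" by simp
      also have "\<dots> \<in> V2" using subspace_diff[OF D(3) g h] .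
      finally have "h *s e2 - g *s e \<in> V2" .
      moreover have "h *s e2 - g *s e \<in> V1"
        using e(1) e2V subspace_diff[OF D(2)] subspace_scale[OF D(2)] by simp
      ultimately have "h *s e2 - g *s e = 0" using bisec_disjoint[OF V] by blast
      then have "h = 0" using e2[of g] scalar_cases[OF q, of h] by auto
      then show "z \<in> V2" using h by simp
    qed
    then show ?thesis using card_subset_eq[OF D(12), of W2] D(9) E(9) ne(2) by simp
  qed
qed

text \<open>If no component is shared, \<open>P\<close> gives a 2 by 2 matrix of truth values with
  rows \<open>V1\<close>, \<open>V2\<close> and columns \<open>W1\<close>, \<open>W2\<close>. A row
  or column that is true throughout is a cross position, one that is false throughout is the
  disjoint position, and the only other matrices are the two permutation matrices, which are
  diagonal positions up to swapping \<open>W1\<close> and \<open>W2\<close>.\<close>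

lemma universally_common_compl_3:
  assumes q: "CARD('f) = 2"
  shows "universally_common_compl 3"
  unfolding universally_common_compl_def
proof (intro allI impI)
  fix L V1 V2 W1 W2 assume V: "bisec 3 L V1 V2" and W: "bisec 3 L W1 W2"
  note V' = bisec_commute[OF V] and W' = bisec_commute[OF W]
  define P where "P A B \<longleftrightarrow> (\<exists>x. x \<in> A \<and> x \<in> B \<and> x \<noteq> (0 :: 'v))" for A B
  have PE: thesis if "P A B" "\<And>x. x \<in> A \<Longrightarrow> x \<in> B \<Longrightarrow> x \<noteq> 0 \<Longrightarrow> thesis" for A B thesis
    using that unfolding P_def by blast
  have NP: "x = 0" if "\<not> P A B" "x \<in> A" "x \<in> B" for A B x
    using that unfolding P_def by blast
  have shared: "common_compl 3 L {X1, X2, Y1, Y2}"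
    if "bisec 3 L X1 X2" "bisec 3 L Y1 Y2" "X1 = Y1" for X1 X2 Y1 Y2
    using common_compl_3_shared[OF q that(1)] that(2,3) by simp
  have cross: "common_compl 3 L {X1, X2, Y1, Y2}"
    if X: "bisec 3 L X1 X2" and Y: "bisec 3 L Y1 Y2" and P: "P X1 Y1" "P X1 Y2" for X1 X2 Y1 Y2
  proof -
    obtain x where x: "x \<in> X1" "x \<in> Y1" "x \<noteq> 0" using P(1) by (rule PE)
    obtain y where y: "y \<in> X1" "y \<in> Y2" "y \<noteq> 0" using P(2) by (rule PE)
    show ?thesis using common_compl_3_cross[OF q X Y x y] .
  qed
  have disj: "common_compl 3 L {X1, X2, Y1, Y2}"
    if X: "bisec 3 L X1 X2" and Y: "bisec 3 L Y1 Y2" and P: "\<not> P X1 Y1" "\<not> P X1 Y2"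
      and ne: "X2 \<noteq> Y1" "X2 \<noteq> Y2" for X1 X2 Y1 Y2
    by (rule common_compl_3_disjoint[OF q X Y NP[OF P(1)] NP[OF P(2)] ne])
  have diag: "common_compl 3 L {X1, X2, Y1, Y2}"
    if X: "bisec 3 L X1 X2" and Y: "bisec 3 L Y1 Y2" and P: "P X1 Y1" "P X2 Y2" "\<not> P X1 Y2" "\<not> P X2 Y1"
      and ne: "X1 \<noteq> Y1" "X2 \<noteq> Y2" for X1 X2 Y1 Y2
  proof -
    obtain x where x: "x \<in> X1" "x \<in> Y1" "x \<noteq> 0" using P(1) by (rule PE)
    obtain y where y: "y \<in> X2" "y \<in> Y2" "y \<noteq> 0" using P(2) by (rule PE)
    show ?thesis by (rule common_compl_3_diagonal[OF q X Y x y NP[OF P(3)] NP[OF P(4)] ne])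
  qed
  have P_commute: "P A B = P B A" for A B unfolding P_def by blast
  have perm: "{V1, V2, W2, W1} = {V1, V2, W1, W2}" "{V2, V1, W1, W2} = {V1, V2, W1, W2}"
    "{V2, V1, W2, W1} = {V1, V2, W1, W2}" "{W1, W2, V1, V2} = {V1, V2, W1, W2}"
    "{W2, W1, V1, V2} = {V1, V2, W1, W2}"
    by blast+
  consider "V1 = W1" | "V1 = W2" | "V2 = W1" | "V2 = W2"
    | "V1 \<noteq> W1" "V1 \<noteq> W2" "V2 \<noteq> W1" "V2 \<noteq> W2" by blast
  then show "common_compl 3 L {V1, V2, W1, W2}"
  proof cases
    case 1 then show ?thesis using shared[OF V W] by simp
  next
    case 2 then show ?thesis using shared[OF V W'] unfolding perm by simp
  next
    case 3 then show ?thesis using shared[OF V' W] unfolding perm by simp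
  next
    case 4 then show ?thesis using shared[OF V' W'] unfolding perm by simp
  next
    case ne: 5
    show ?thesis
      using cross[OF V W] cross[OF V' W, unfolded perm] cross[OF W V, unfolded perm]
        cross[OF W' V, unfolded perm] disj[OF V W _ _ ne(3,4)] disj[OF V' W _ _ ne(1,2), unfolded perm]
        disj[OF W V _ _ ne(2,4)[symmetric], unfolded perm]
        disj[OF W' V _ _ ne(1,3)[symmetric], unfolded perm]
        diag[OF V W _ _ _ _ ne(1,4)] diag[OF V W' _ _ _ _ ne(2,3), unfolded perm]
        P_commute[of W1] P_commute[of W2]
      by metis
  qed
qed

section \<open>The geometry\<close>

lemma universally_common_compl_if:
  assumes "(CARD('f), k) \<notin> {(2, 1), (3, 1), (2, 2)}"
  shows "universally_common_compl k"
proof (cases "k = 0")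
  case False
  consider "4 \<le> CARD('f)" | "CARD('f) = 3" | "CARD('f) = 2" using card_field_ge_2 by linarith
  then show ?thesis
  proof cases
    case 1
    then show ?thesis
      using universally_common_compl_mono[OF universally_common_compl_0, of k] by simp
  next
    case 2
    then have "2 \<le> k" using assms False by auto
    then show ?thesis
      using universally_common_compl_mono[OF universally_common_compl_2, of k] 2 by simp
  next
    case 3
    then have "k \<noteq> 1" "k \<noteq> 2" using assms by auto
    then have "3 \<le> k" using False by linarith
    then show ?thesis
      using universally_common_compl_mono[OF universally_common_compl_3, of k] 3 by simp
  qed
qed (simp add: universally_common_compl_0)

text \<open>Part (i) includes the pairs (3,1) and (2,2), where arbitrary bisections need not have a
  common complement. The bisections used in \<open>four_disjoint\<close> share a component, and for
  those only (2,1) has to be excluded.\<close>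

lemma common_compl_shared:
  assumes "(CARD('f), k) \<noteq> (2, 1)" "bisec k L A V" "bisec k L A W"
  shows "common_compl k L {A, V, A, W}"
proof -
  consider "(CARD('f), k) \<notin> {(2, 1), (3, 1), (2, 2)}" | "CARD('f) = 3" "k = 1" | "CARD('f) = 2" "k = 2"
    using assms(1) by auto
  then show ?thesis
  proof cases
    case 1
    then show ?thesis
      using universally_common_complD[OF universally_common_compl_if assms(2,3)] by blast
  next
    case 2
    then show ?thesis using common_compl_1_shared[of L A V W] assms(2,3) by simp
  next
    case 3
    then show ?thesis using common_compl_2_shared[of L A V W] assms(2,3) by simp
  qed
qed

lemma four_disjoint:
  assumes "(CARD('f), k) \<noteq> (2, 1)" and V: "bisec k L V1 V2"
  obtains W1 W2 where "bisec k L W1 W2" "V1 \<inter> W1 = {0}" "V1 \<inter> W2 = {0}" "V2 \<inter> W1 = {0}" "V2 \<inter> W2 = {0}"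
proof -
  note D = bisecD[OF V]
  \<comment> \<open>The bisection is paired with itself here, and with \<open>{V1, W1}\<close>
    below; both pairs share \<open>V1\<close>.\<close>
  obtain W1 where W1: "subspace W1" "W1 \<subseteq> L" "card W1 = CARD('f) ^ k" "W1 \<inter> V1 = {0}" "W1 \<inter> V2 = {0}"
    using common_compl_shared[OF assms(1) V V] by (auto simp: common_compl_def)
  have B: "bisec k L V1 W1" using D W1 by (simp add: bisec_def Int_commute)
  obtain W2 where W2: "subspace W2" "W2 \<subseteq> L" "card W2 = CARD('f) ^ k"
    "W2 \<inter> V1 = {0}" "W2 \<inter> V2 = {0}" "W2 \<inter> W1 = {0}"
    using common_compl_shared[OF assms(1) V B] by (auto simp: common_compl_def)
  have "bisec k L W1 W2" using D W1 W2 by (simp add: bisec_def Int_commute)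
  then show ?thesis using that W1(4,5) W2(4,5) by (simp add: Int_commute)
qed

section \<open>Dimensions, cardinalities and the incidence relation\<close>

lemma finite_UNIV_if_dim_pos:
  assumes "0 < dim UNIV"
  shows "finite (UNIV :: 'v set)"
proof -
  obtain B where B: "independent B" "UNIV \<subseteq> span B" "card B = dim UNIV" by (rule basis_exists)
  \<comment> \<open>An infinite basis would have \<open>card B = 0\<close>, so positive dimension
    makes it finite.\<close>
  then have "finite B" using assms by (intro card_ge_0_finite) simp
  then have "card (span B) = CARD('f) ^ card B" using card_span_independent B(1) by blast
  then have "finite (span B)" by (intro card_ge_0_finite) simp
  then show ?thesis by (rule finite_subset[OF B(2)])
qed

lemma card_eq_power_dim:
  assumes "finite (UNIV :: 'v set)" "subspace A"
  shows "card A = CARD('f) ^ dim A"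
proof -
  obtain B where B: "B \<subseteq> A" "independent B" "A \<subseteq> span B" "card B = dim A" by (rule basis_exists)
  then have "span B = A" using span_minimal[OF B(1) assms(2)] by blast
  moreover have "finite B" by (rule finite_subset[OF subset_UNIV assms(1)])
  ultimately show ?thesis using card_span_independent[OF _ B(2)] B(4) by simp
qed

lemma dim_eq_iff_card:
  assumes "finite (UNIV :: 'v set)" "subspace A"
  shows "dim A = j \<longleftrightarrow> card A = CARD('f) ^ j"
  using card_eq_power_dim[OF assms] card_field_ge_2 by simp

lemma dim_eq_0_iff_trivial:
  assumes "finite (UNIV :: 'v set)" "subspace A"
  shows "dim A = 0 \<longleftrightarrow> A = {0}"
proof -
  have "dim A = 0 \<longleftrightarrow> card A = 1" using dim_eq_iff_card[OF assms, of 0] by simp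
  also have "\<dots> \<longleftrightarrow> A = {0}" using subspace_0[OF assms(2)] by (auto simp: card_1_singleton_iff)
  finally show ?thesis .
qed

lemma exists_subspace_of_dim:
  assumes "finite (UNIV :: 'v set)" "subspace U" "m \<le> dim U"
  obtains W where "subspace W" "W \<subseteq> U" "dim W = m"
proof -
  obtain B where B: "B \<subseteq> U" "independent B" "U \<subseteq> span B" "card B = dim U" by (rule basis_exists)
  obtain C where C: "C \<subseteq> B" "card C = m" using obtain_subset_with_card_n[of m B] B(4) assms(3) by metis
  have "independent C" using B(2) C(1) independent_mono by blast
  then have "dim (span C) = m" using dim_span_eq_card_independent C(2) by simp
  moreover have "span C \<subseteq> U" using span_minimal[OF subset_trans[OF C(1) B(1)] assms(2)] .
  ultimately show ?thesis using that[of "span C"] by simp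
qed

lemma exists_bisec:
  assumes "dim UNIV = 2 * k" "1 \<le> k"
  obtains V1 V2 where "bisec k UNIV V1 V2"
proof -
  have fin: "finite (UNIV :: 'v set)" using finite_UNIV_if_dim_pos assms by simp
  obtain B where B: "independent B" "UNIV \<subseteq> span B" "card B = dim UNIV" by (rule basis_exists)
  obtain C where C: "C \<subseteq> B" "card C = k"
    using obtain_subset_with_card_n[of k B] B(3) assms by (metis le_add1 mult_2)
  have finB: "finite B" "finite C" "finite (B - C)" by (rule finite_subset[OF subset_UNIV fin])+
  have "independent C" "independent (B - C)" using B(1) C(1) independent_mono by blast+
  then have card: "card (span C) = CARD('f) ^ k" "card (span (B - C)) = CARD('f) ^ k"
    using card_span_independent finB C B(3) assms(1) by (simp_all add: card_Diff_subset)
  have cardU: "card (UNIV :: 'v set) = CARD('f) ^ (2 * k)"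
    using card_eq_power_dim[OF fin subspace_UNIV] assms(1) by simp
  have "C \<union> (B - C) = B" using C(1) by blast
  then have "UNIV \<subseteq> {x + y | x y. x \<in> span C \<and> y \<in> span (B - C)}" using B(2) span_Un[of C "B - C"] by simp
  \<comment> \<open>The two halves of the basis span the whole space, and their sizes then force
    trivial intersection.\<close>
  then have "span C \<inter> span (B - C) = {0}"
    using card cardU finite_subset[OF subset_UNIV fin]
    by (intro trivial_inter_of_sum[where L = UNIV]) (simp_all add: power_add[symmetric] mult_2)
  then show ?thesis using that[of "span C" "span (B - C)"] card cardU by (simp add: bisec_def)
qed

lemma bisec_iff:
  assumes "dim UNIV = 2 * k" "1 \<le> k"
  shows "internal_direct_sum scale V1 V2 \<and> dim V1 = k \<and> dim V2 = k \<longleftrightarrow> bisec k UNIV V1 V2"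
proof -
  have fin: "finite (UNIV :: 'v set)" using finite_UNIV_if_dim_pos assms by simp
  have cardU: "card (UNIV :: 'v set) = CARD('f) ^ (2 * k)"
    using card_eq_power_dim[OF fin subspace_UNIV] assms(1) by simp
  have "{x + y | x y. x \<in> V1 \<and> y \<in> V2} = UNIV" if V: "bisec k UNIV V1 V2"
  proof -
    have "z \<in> {x + y | x y. x \<in> V1 \<and> y \<in> V2}" for z
    proof -
      obtain x where "x \<in> V1" "z - x \<in> V2" using bisec_decomp[OF V UNIV_I] by metis
      moreover have "z = x + (z - x)" by simp
      ultimately show ?thesis by blast
    qed
    then show ?thesis by blast
  qed
  moreover have "dim V1 = k \<and> dim V2 = k \<longleftrightarrow> card V1 = CARD('f) ^ k \<and> card V2 = CARD('f) ^ k"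
    if "subspace V1 \<and> subspace V2"
    using dim_eq_iff_card[OF fin] that by blast
  ultimately show ?thesis using cardU unfolding internal_direct_sum_def bisec_def by auto
qed

lemma lines_iff:
  assumes "dim UNIV = 2 * k" "1 \<le> k"
  shows "l \<in> lines (subspace_bisection_geometry scale m k k1 k2) \<longleftrightarrow>
    (\<exists>V1 V2. l = {V1, V2} \<and> bisec k UNIV V1 V2)"
  using bisec_iff[OF assms] by (auto simp: subspace_bisection_geometry_def bisections_def)

lemma points_iff:
  "U \<in> points (subspace_bisection_geometry scale m k k1 k2) \<longleftrightarrow> subspace U \<and> dim U = m"
  by (simp add: subspace_bisection_geometry_def)

lemma incident_iff:
  "incident (subspace_bisection_geometry scale m k k1 k2) U {V1, V2} \<longleftrightarrow>
    (dim (U \<inter> V1), dim (U \<inter> V2)) \<in> {(k1, k2), (k2, k1)}"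
  by (auto simp: subspace_bisection_geometry_def doubleton_eq_iff)

lemma concurrently_complete_iff:
  assumes "dim UNIV = 2 * k" "1 \<le> k"
  shows "concurrently_complete (subspace_bisection_geometry scale m k k1 k2) \<longleftrightarrow>
    (\<forall>V1 V2 W1 W2. bisec k UNIV V1 V2 \<longrightarrow> bisec k UNIV W1 W2 \<longrightarrow> {V1, V2} \<noteq> {W1, W2} \<longrightarrow>
      (\<exists>U. subspace U \<and> dim U = m \<and> (dim (U \<inter> V1), dim (U \<inter> V2)) \<in> {(k1, k2), (k2, k1)} \<and>
        (dim (U \<inter> W1), dim (U \<inter> W2)) \<in> {(k1, k2), (k2, k1)}))"
  (is "concurrently_complete ?G \<longleftrightarrow> ?R")
proof
  assume L: "concurrently_complete ?G"
  show ?R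
  proof (intro allI impI)
    fix V1 V2 W1 W2
    assume "bisec k UNIV V1 V2" "bisec k UNIV W1 W2" and ne: "{V1, V2} \<noteq> {W1, W2}"
    then have "{V1, V2} \<in> lines ?G" "{W1, W2} \<in> lines ?G" using lines_iff[OF assms] by blast+
    then obtain U where "U \<in> points ?G" "incident ?G U {V1, V2}" "incident ?G U {W1, W2}"
      using L[unfolded concurrently_complete_def, rule_format, OF _ _ ne] by blast
    then show "\<exists>U. subspace U \<and> dim U = m \<and> (dim (U \<inter> V1), dim (U \<inter> V2)) \<in> {(k1, k2), (k2, k1)} \<and>
        (dim (U \<inter> W1), dim (U \<inter> W2)) \<in> {(k1, k2), (k2, k1)}"
      unfolding points_iff incident_iff by (elim conjE) (intro exI[of _ U] conjI)
  qed
next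
  assume R: ?R
  show "concurrently_complete ?G" unfolding concurrently_complete_def
  proof (intro ballI impI)
    fix l l' assume ll: "l \<in> lines ?G" "l' \<in> lines ?G" "l \<noteq> l'"
    obtain V1 V2 where V: "l = {V1, V2}" "bisec k UNIV V1 V2" using iffD1[OF lines_iff[OF assms] ll(1)] by blast
    obtain W1 W2 where W: "l' = {W1, W2}" "bisec k UNIV W1 W2" using iffD1[OF lines_iff[OF assms] ll(2)] by blast
    obtain U where U: "subspace U" "dim U = m"
      "(dim (U \<inter> V1), dim (U \<inter> V2)) \<in> {(k1, k2), (k2, k1)}"
      "(dim (U \<inter> W1), dim (U \<inter> W2)) \<in> {(k1, k2), (k2, k1)}"
      using R[rule_format, OF V(2) W(2)] ll(3) V(1) W(1) by metis
    then have "U \<in> points ?G" "incident ?G U l" "incident ?G U l'"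
      unfolding points_iff V(1) W(1) incident_iff by blast+
    then show "\<exists>p\<in>points ?G. incident ?G p l \<and> incident ?G p l'" by blast
  qed
qed

lemma concurrently_complete_00_iff:
  assumes "dim UNIV = 2 * k" "1 \<le> k"
  shows "concurrently_complete (subspace_bisection_geometry scale m k 0 0) \<longleftrightarrow>
    (\<forall>V1 V2 W1 W2. bisec k UNIV V1 V2 \<longrightarrow> bisec k UNIV W1 W2 \<longrightarrow> {V1, V2} \<noteq> {W1, W2} \<longrightarrow>
      (\<exists>U. subspace U \<and> dim U = m \<and> (\<forall>A\<in>{V1, V2, W1, W2}. U \<inter> A = {0})))"
proof -
  have fin: "finite (UNIV :: 'v set)" using finite_UNIV_if_dim_pos assms by simp
  have *: "(dim (U \<inter> A), dim (U \<inter> B)) \<in> {(0, 0), (0, 0)} \<longleftrightarrow> U \<inter> A = {0} \<and> U \<inter> B = {0}"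
    if "subspace U" "bisec k UNIV A B" for U A B
    using dim_eq_0_iff_trivial[OF fin subspace_inter[OF that(1) bisecD(2)[OF that(2)]]]
      dim_eq_0_iff_trivial[OF fin subspace_inter[OF that(1) bisecD(3)[OF that(2)]]] by simp
  show ?thesis unfolding concurrently_complete_iff[OF assms]
  proof (intro iff_allI imp_cong[OF refl] iff_exI conj_cong[OF refl])
    fix V1 V2 W1 W2 U
    assume V: "bisec k UNIV V1 V2" and W: "bisec k UNIV W1 W2" and U: "subspace U"
    show "(dim (U \<inter> V1), dim (U \<inter> V2)) \<in> {(0, 0), (0, 0)} \<and>
        (dim (U \<inter> W1), dim (U \<inter> W2)) \<in> {(0, 0), (0, 0)} \<longleftrightarrow>
      (\<forall>A\<in>{V1, V2, W1, W2}. U \<inter> A = {0})"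
      unfolding *[OF U V] *[OF U W] by simp
  qed
qed

section \<open>Points that meet a component in more than half of their dimension\<close>

lemma bisec_ne:
  assumes "bisec k L V1 V2" "bisec k L W1 W2" "1 \<le> k" "V1 \<inter> W1 = {0}" "V1 \<inter> W2 = {0}"
  shows "{V1, V2} \<noteq> {W1, W2}"
proof
  assume "{V1, V2} = {W1, W2}"
  then have "V1 = {0}" using assms(4,5) by (auto simp: doubleton_eq_iff)
  then have "CARD('f) ^ k = 1" using bisecD(8)[OF assms(1)] by simp
  then show False using assms(3) card_field_ge_2 by simp
qed

lemma not_concurrently_complete_if_large:
  assumes d: "dim UNIV = 2 * k" "1 \<le> k" and ne: "(CARD('f), k) \<noteq> (2, 1)" and m: "m < 2 * k2"
  shows "\<not> concurrently_complete (subspace_bisection_geometry scale m k k1 k2)"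
proof
  assume cc: "concurrently_complete (subspace_bisection_geometry scale m k k1 k2)"
  have fin: "finite (UNIV :: 'v set)" using finite_UNIV_if_dim_pos d by simp
  obtain V1 V2 where V: "bisec k UNIV V1 V2" by (rule exists_bisec[OF d])
  obtain W1 W2 where W: "bisec k UNIV W1 W2" and
    disj: "V1 \<inter> W1 = {0}" "V1 \<inter> W2 = {0}" "V2 \<inter> W1 = {0}" "V2 \<inter> W2 = {0}"
    by (rule four_disjoint[OF ne V])
  note D = bisecD[OF V] and E = bisecD[OF W]
  obtain U where U: "subspace U" "dim U = m"
    "(dim (U \<inter> V1), dim (U \<inter> V2)) \<in> {(k1, k2), (k2, k1)}"
    "(dim (U \<inter> W1), dim (U \<inter> W2)) \<in> {(k1, k2), (k2, k1)}"
    using iffD1[OF concurrently_complete_iff[OF d] cc, rule_format, OF V W bisec_ne[OF V W d(2) disj(1,2)]]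
    by metis
  have no: False if "subspace A" "subspace B" "A \<inter> B = {0}" "dim (U \<inter> A) = k2" "dim (U \<inter> B) = k2" for A B
  proof -
    note S = subspace_inter[OF U(1) that(1)] subspace_inter[OF U(1) that(2)]
    have "(U \<inter> A) \<inter> (U \<inter> B) = {0}" using that(3) subspace_0[OF U(1)] by blast
    then have "card (U \<inter> A) * card (U \<inter> B) \<le> card U"
      using card_direct_sum_le(1)[OF S U(1) _ _ _ finite_subset[OF subset_UNIV fin]] by simp
    then have "CARD('f) ^ (k2 + k2) \<le> CARD('f) ^ m"
      using card_eq_power_dim[OF fin] S U(1,2) that(4,5) by (simp add: power_add)
    then have "k2 + k2 \<le> m" using card_field_ge_2 by simp
    then show False using m by simp
  qed
  show False
    using U(3,4) no[OF D(2) E(2) disj(1)] no[OF D(2) E(3) disj(2)] no[OF D(3) E(2) disj(3)]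
      no[OF D(3) E(3) disj(4)] by auto
qed

text \<open>A plane over two elements has only three nonzero vectors, that is, three lines. Two
  bisections use two lines each, so they share one, and this line is a point incident with
  both.\<close>

lemma concurrently_complete_2_1:
  assumes q: "CARD('f) = 2" and d: "dim UNIV = 2 * 1"
  shows "concurrently_complete (subspace_bisection_geometry scale 1 1 0 1)"
proof (rule iffD2[OF concurrently_complete_iff[OF d order_refl]], intro allI impI)
  fix V1 V2 W1 W2 assume V: "bisec 1 UNIV V1 V2" and W: "bisec 1 UNIV W1 W2"
  have fin: "finite (UNIV :: 'v set)" using finite_UNIV_if_dim_pos d by simp
  note D = bisecD[OF V] and E = bisecD[OF W]
  have nz: "\<exists>x. x \<in> A \<and> x \<noteq> 0" if "card A = CARD('f) ^ 1" for A :: "'v set"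
  proof (rule ccontr)
    assume "\<nexists>x. x \<in> A \<and> x \<noteq> 0"
    then have "A \<subseteq> {0}" by blast
    then show False using card_mono[of "{0}" A] that q by simp
  qed
  obtain a b c e where abce: "a \<in> V1" "a \<noteq> 0" "b \<in> V2" "b \<noteq> 0" "c \<in> W1" "c \<noteq> 0" "e \<in> W2" "e \<noteq> 0"
    using nz[OF D(8)] nz[OF D(9)] nz[OF E(8)] nz[OF E(9)] by blast
  have "card {0, a, b, c, e} \<le> card (UNIV :: 'v set)" using fin by (intro card_mono) auto
  then have "card {0, a, b, c, e} \<le> 4" using D(7) q by simp
  moreover have "a \<noteq> b" "c \<noteq> e"
    using bisec_disjoint[OF V abce(1)] bisec_disjoint[OF W abce(5)] abce by auto
  ultimately have "a = c \<or> a = e \<or> b = c \<or> b = e" using abce by (auto simp: card_insert_if split: if_splits)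
  then obtain A B x where AB: "A = V1 \<or> A = V2" "B = W1 \<or> B = W2" "x \<in> A" "x \<in> B" "x \<noteq> 0"
    using abce by blast
  have A: "subspace A" "card A = CARD('f) ^ 1" and B: "subspace B" "card B = CARD('f) ^ 1"
    using AB(1,2) D E by auto
  have "A = B" using subspace_eq_line[OF A(1) _ AB(3,5)] subspace_eq_line[OF B(1) _ AB(4,5)] A B by simp
  have dims: "dim (A \<inter> A) = 1" "dim {0} = 0"
    using dim_eq_iff_card[OF fin A(1)] A(2) dim_eq_0_iff_trivial[OF fin subspace_single_0] by simp_all
  have V': "(dim (A \<inter> V1), dim (A \<inter> V2)) \<in> {(0, 1), (1, 0)}"
    using AB(1) dims D(6) by (auto simp: Int_commute)
  have W': "(dim (A \<inter> W1), dim (A \<inter> W2)) \<in> {(0, 1), (1, 0)}"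
    using AB(2) dims E(6) \<open>A = B\<close> by (auto simp: Int_commute)
  show "\<exists>U. subspace U \<and> dim U = 1 \<and> (dim (U \<inter> V1), dim (U \<inter> V2)) \<in> {(0, 1), (1, 0)} \<and>
      (dim (U \<inter> W1), dim (U \<inter> W2)) \<in> {(0, 1), (1, 0)}"
    using A(1) dims(1) V' W' by (intro exI[of _ A]) simp
qed

section \<open>Points that miss both components, for the exceptional pairs\<close>

lemma not_concurrently_complete_if_cover:
  assumes d: "dim UNIV = 2 * k" "1 \<le> k" and V: "bisec k UNIV V1 V2" and W: "bisec k UNIV W1 W2"
    and ne: "{V1, V2} \<noteq> {W1, W2}" and S: "subspace S" "S \<subseteq> V1 \<union> V2 \<union> W1 \<union> W2"
    and card: "CARD('f) ^ (2 * k) < CARD('f) ^ m * card S"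
  shows "\<not> concurrently_complete (subspace_bisection_geometry scale m k 0 0)"
proof
  assume cc: "concurrently_complete (subspace_bisection_geometry scale m k 0 0)"
  have fin: "finite (UNIV :: 'v set)" using finite_UNIV_if_dim_pos d by simp
  obtain U where U: "subspace U" "dim U = m" "\<forall>A\<in>{V1, V2, W1, W2}. U \<inter> A = {0}"
    using iffD1[OF concurrently_complete_00_iff[OF d] cc, rule_format, OF V W ne] by metis
  have "x = 0" if "x \<in> U" "x \<in> S" for x
  proof -
    have "x \<in> V1 \<or> x \<in> V2 \<or> x \<in> W1 \<or> x \<in> W2" using S(2) that(2) by blast
    then show ?thesis using U(3) that(1) by blast
  qed
  then have "U \<inter> S = {0}" using subspace_0[OF U(1)] subspace_0[OF S(1)] by blast
  then have "card U * card S \<le> card (UNIV :: 'v set)"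
    using card_direct_sum_le(1)[OF U(1) S(1) subspace_UNIV _ _ _ fin] by simp
  then show False using card bisecD(7)[OF V] card_eq_power_dim[OF fin U(1)] U(2) by simp
qed

text \<open>The lines through \<open>a\<close>, \<open>b\<close> and \<open>a + b\<close> are all
  the lines of the plane; the bisections formed by the first and second and by the first and third
  cover it.\<close>

lemma not_concurrently_complete_2_1:
  assumes q: "CARD('f) = 2" and d: "dim UNIV = 2 * 1"
  shows "\<not> concurrently_complete (subspace_bisection_geometry scale 1 1 0 0)"
proof -
  obtain V1 V2 where V: "bisec 1 UNIV V1 V2" by (rule exists_bisec[OF d order_refl])
  note D = bisecD[OF V]
  have "\<not> V1 \<subseteq> {0}" "\<not> V2 \<subseteq> {0}" using card_mono[of "{0}" V1] card_mono[of "{0}" V2] D(8,9) q by auto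
  then obtain a b where ab: "a \<in> V1" "a \<noteq> 0" "b \<in> V2" "b \<noteq> 0" by blast
  have eq: "V1 = span {a}" "V2 = span {b}"
    using subspace_eq_line[OF D(2) _ ab(1,2)] subspace_eq_line[OF D(3) _ ab(3,4)] D(8,9) by simp_all
  have ab1: "a + b \<notin> V1"
    using subspace_diff[OF D(2) _ ab(1), of "a + b"] bisec_disjoint[OF V, of b] ab(3,4) by auto
  then have ab0: "a + b \<noteq> 0" using D(14) by auto
  let ?W = "span {a + b}"
  have W: "card ?W = CARD('f)" using card_span_independent[of "{a + b}"] ab0 by (simp add: independent_insert)
  have "x = 0" if x: "x \<in> V1" "x \<in> ?W" for x
  proof -
    obtain c where c: "x = c *s (a + b)" using x(2) by (auto simp: span_singleton)
    then have "c = 0" using mem_of_scale_mem[OF D(2), of c "a + b"] x(1) ab1 by blast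
    then show ?thesis using c by simp
  qed
  then have "V1 \<inter> ?W = {0}" using D(14) span_zero by blast
  then have B: "bisec 1 UNIV V1 ?W" using D W by (simp add: bisec_def)
  have "b \<notin> ?W"
  proof
    assume "b \<in> ?W"
    then obtain c where c: "b = c *s (a + b)" by (auto simp: span_singleton)
    then show False using scalar_cases[OF q, of c] ab by auto
  qed
  moreover have "b \<notin> V1" using bisec_disjoint[OF V] ab(3,4) by blast
  ultimately have ne: "{V1, V2} \<noteq> {V1, ?W}" using ab(3) by (auto simp: doubleton_eq_iff)
  have "z \<in> V1 \<union> V2 \<union> V1 \<union> ?W" for z
  proof -
    obtain x where x: "x \<in> V1" "z - x \<in> V2" using bisec_decomp[OF V UNIV_I] by metis
    obtain c where c: "x = c *s a" using x(1) eq(1) by (auto simp: span_singleton)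
    obtain e where e: "z - x = e *s b" using x(2) eq(2) by (auto simp: span_singleton)
    have z: "z = c *s a + e *s b" using c e by (simp add: algebra_simps)
    show ?thesis using scalar_cases[OF q, of c] scalar_cases[OF q, of e] z ab(1,3) D(14) span_base[of "a + b" "{a + b}"]
      by auto
  qed
  then have "UNIV \<subseteq> V1 \<union> V2 \<union> V1 \<union> ?W" by blast
  then show ?thesis
    using not_concurrently_complete_if_cover[OF d order_refl V B ne subspace_UNIV] D(7) q by simp
qed

text \<open>The four lines from \<open>four_disjoint\<close> have 4 * 2 nonzero vectors, and
  together with 0 these are all 9 vectors of the plane.\<close>

lemma not_concurrently_complete_3_1:
  assumes q: "CARD('f) = 3" and d: "dim UNIV = 2 * 1"
  shows "\<not> concurrently_complete (subspace_bisection_geometry scale 1 1 0 0)"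
proof -
  have fin: "finite (UNIV :: 'v set)" using finite_UNIV_if_dim_pos d by simp
  obtain V1 V2 where V: "bisec 1 UNIV V1 V2" by (rule exists_bisec[OF d order_refl])
  have "(CARD('f), 1 :: nat) \<noteq> (2, 1)" using q by simp
  then obtain W1 W2 where W: "bisec 1 UNIV W1 W2" and
    disj: "V1 \<inter> W1 = {0}" "V1 \<inter> W2 = {0}" "V2 \<inter> W1 = {0}" "V2 \<inter> W2 = {0}"
    using V by (rule four_disjoint)
  note D = bisecD[OF V] and E = bisecD[OF W]
  let ?V1 = "V1 - {0}" and ?V2 = "V2 - {0}" and ?W1 = "W1 - {0}" and ?W2 = "W2 - {0}"
  have "card (?V1 \<union> ?V2 \<union> ?W1 \<union> ?W2) = card ?V1 + card ?V2 + card ?W1 + card ?W2"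
  proof -
    have *: "(A - {0}) \<inter> (B - {0}) = {}" if "A \<inter> B = {0}" for A B :: "'v set"
      using that by blast
    have "?V1 \<inter> ?V2 = {}" "(?V1 \<union> ?V2) \<inter> ?W1 = {}" "(?V1 \<union> ?V2 \<union> ?W1) \<inter> ?W2 = {}"
      unfolding Int_Un_distrib2 using *[OF D(6)] *[OF E(6)] disj[THEN *] by simp_all
    then show ?thesis using D(11,12) E(11,12) by (simp add: card_Un_disjoint)
  qed
  also have "\<dots> = 8" using D(8,9,11,12,14,15) E(8,9,11,12,14,15) q by (simp add: card_Diff_singleton)
  finally have "card (insert 0 (?V1 \<union> ?V2 \<union> ?W1 \<union> ?W2)) = 9"
    using D(11,12) E(11,12) by (subst card_insert_disjoint) auto
  then have U: "insert 0 (?V1 \<union> ?V2 \<union> ?W1 \<union> ?W2) = UNIV"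
    using D(7) q by (intro card_subset_eq fin) auto
  have "insert 0 (?V1 \<union> ?V2 \<union> ?W1 \<union> ?W2) \<subseteq> V1 \<union> V2 \<union> W1 \<union> W2" using D(14) by auto
  then have "UNIV \<subseteq> V1 \<union> V2 \<union> W1 \<union> W2" unfolding U .
  then show ?thesis
    using not_concurrently_complete_if_cover[OF d order_refl V W bisec_ne[OF V W order_refl disj(1,2)] subspace_UNIV]
      D(7) q by simp
qed

lemma exists_basis_two:
  assumes "subspace A" "card A = CARD('f) ^ 2"
  obtains a b where "A = span {a, b}" "b \<noteq> 0" "a \<notin> span {b}"
proof -
  have fin: "finite A" using assms(2) by (intro card_ge_0_finite) simp
  have q: "CARD('f) < CARD('f) ^ 2" using card_field_ge_2 by (simp add: power2_eq_square)
  then have "\<not> A \<subseteq> {0}" using card_mono[of "{0}" A] assms(2) card_field_ge_2 by auto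
  then obtain b where b: "b \<in> A" "b \<noteq> 0" by blast
  have "card (span {b}) = CARD('f)" "finite (span {b})"
    using card_span_independent[of "{b}"] b(2) card_span_le[of "{b}"] by (simp_all add: independent_insert)
  then have "\<not> A \<subseteq> span {b}" using card_mono[of "span {b}" A] assms(2) q by auto
  then obtain a where a: "a \<in> A" "a \<notin> span {b}" by blast
  have sub: "span {a, b} \<subseteq> A" using span_minimal[of "{a, b}" A] a(1) b(1) assms(1) by simp
  have "A = span {a, b}"
    using card_subset_eq[OF fin sub] card_span_two[OF b(2) a(2)] assms(2) by simp
  then show ?thesis using that b(2) a(2) by blast
qed

lemma lincomb_two_eq_0:
  assumes "c *s a + d *s b = 0" "b \<noteq> 0" "a \<notin> span {b}"
  shows "c = 0" "d = 0"
proof -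
  have "c *s a = (- d) *s b" using assms(1) by (simp add: eq_neg_iff_add_eq_0)
  then have "c *s a \<in> span {b}" using span_scale[OF span_base[of b "{b}"], of "- d"] by simp
  then show "c = 0" using mem_of_scale_mem[OF subspace_span, of c a "{b}"] assms(3) by blast
  then show "d = 0" using assms(1,2) by simp
qed

text \<open>The covered subspace is the three-dimensional span of \<open>a\<close> and
  \<open>V2\<close>. It consists of \<open>V2\<close> and the coset of \<open>a\<close>, whose four
  vectors are \<open>a\<close> in \<open>V1\<close>, \<open>a + f\<close> in \<open>?W1\<close>, and
  \<open>a + g\<close> and \<open>a + f + g\<close> in \<open>?W2\<close>. The second bisection is
  made to measure for this.\<close>

lemma not_concurrently_complete_2_2:
  assumes q: "CARD('f) = 2" and d: "dim UNIV = 2 * 2"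
  shows "\<not> concurrently_complete (subspace_bisection_geometry scale 2 2 0 0)"
proof -
  obtain V1 V2 where V: "bisec 2 UNIV V1 V2" using exists_bisec[OF d] by auto
  note D = bisecD[OF V]
  obtain a b where ab: "V1 = span {a, b}" "b \<noteq> 0" "a \<notin> span {b}" by (rule exists_basis_two[OF D(2,8)])
  obtain f g where fg: "V2 = span {f, g}" "g \<noteq> 0" "f \<notin> span {g}" by (rule exists_basis_two[OF D(3,9)])
  have mem: "a \<in> V1" "b \<in> V1" "f \<in> V2" "g \<in> V2" unfolding ab(1) fg(1) by (auto intro: span_base)
  have indep: "c = 0 \<and> h = 0 \<and> i = 0 \<and> j = 0" if eq: "c *s a + h *s b + (i *s f + j *s g) = 0" for c h i j
  proof -
    have neg: "c *s a + h *s b = - (i *s f + j *s g)" using eq by (simp only: eq_neg_iff_add_eq_0)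
    have "c *s a + h *s b \<in> V1"
      using subspace_add[OF D(2) subspace_scale[OF D(2) mem(1)] subspace_scale[OF D(2) mem(2)]] .
    moreover have "c *s a + h *s b \<in> V2" unfolding neg
      using subspace_neg[OF D(3) subspace_add[OF D(3) subspace_scale[OF D(3) mem(3)] subspace_scale[OF D(3) mem(4)]]] .
    ultimately have 0: "c *s a + h *s b = 0" using bisec_disjoint[OF V] by blast
    then have "i *s f + j *s g = 0" using eq by simp
    then show ?thesis using lincomb_two_eq_0[OF 0 ab(2,3)] lincomb_two_eq_0[OF _ fg(2,3)] by blast
  qed
  let ?W1 = "span {a + f, b + g}" and ?W2 = "span {a + g, f}"
  have cardW: "card ?W1 = CARD('f) ^ 2" "card ?W2 = CARD('f) ^ 2"
  proof -
    have "b + g \<noteq> 0" using indep[of 0 1 0 1] by auto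
    moreover have "a + f \<notin> span {b + g}"
    proof
      assume "a + f \<in> span {b + g}"
      then obtain c where "a + f = c *s (b + g)" by (auto simp: span_singleton)
      then have "1 *s a + (- c) *s b + (1 *s f + (- c) *s g) = 0" by (simp add: scale_right_distrib algebra_simps)
      then show False using indep by fastforce
    qed
    ultimately show "card ?W1 = CARD('f) ^ 2" by (rule card_span_two)
    have "f \<noteq> 0" using fg(3) span_zero by auto
    moreover have "a + g \<notin> span {f}"
    proof
      assume "a + g \<in> span {f}"
      then obtain c where "a + g = c *s f" by (auto simp: span_singleton)
      then have "1 *s a + 0 *s b + ((- c) *s f + 1 *s g) = 0" by (simp add: algebra_simps)
      then show False using indep by fastforce
    qed
    ultimately show "card ?W2 = CARD('f) ^ 2" by (rule card_span_two)
  qed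
  have "z = 0" if z: "z \<in> ?W1" "z \<in> ?W2" for z
  proof -
    obtain c h where c: "z = c *s (a + f) + h *s (b + g)" using mem_span_two[OF z(1)] by blast
    obtain i j where i: "z = i *s (a + g) + j *s f" using mem_span_two[OF z(2)] by blast
    have "c *s (a + f) + h *s (b + g) - (i *s (a + g) + j *s f) = 0" using c i by simp
    then have "(c - i) *s a + h *s b + ((c - j) *s f + (h - i) *s g) = 0"
      by (simp add: scale_right_distrib scale_left_diff_distrib algebra_simps)
    then have "c - i = 0 \<and> h = 0 \<and> c - j = 0 \<and> h - i = 0" by (rule indep)
    then have "c = 0" "h = 0" by auto
    then show ?thesis using c by simp
  qed
  then have "?W1 \<inter> ?W2 = {0}" using span_zero by blast
  then have W: "bisec 2 UNIV ?W1 ?W2" using cardW D(7) by (simp add: bisec_def)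
  have W_mem: "a + f \<in> ?W1" "a + g \<in> ?W2" "f \<in> ?W2" by (auto intro: span_base)
  have "f \<notin> V1"
    using bisec_disjoint[OF V _ mem(3)] fg(3) span_zero by auto
  moreover have "a + f \<notin> V1" using subspace_diff[OF D(2) _ mem(1), of "a + f"] calculation by auto
  ultimately have ne: "{V1, V2} \<noteq> {?W1, ?W2}" using W_mem by (metis doubleton_eq_iff)
  have "a + f + g \<in> ?W2" using span_add[OF W_mem(2,3)] by (simp add: algebra_simps)
  then have cov: "a + (i *s f + j *s g) \<in> V1 \<union> V2 \<union> ?W1 \<union> ?W2" for i j
    using scalar_cases[OF q, of i] scalar_cases[OF q, of j] mem(1) W_mem by (auto simp: add.assoc)
  let ?S = "span (insert a V2)"
  have "z \<in> V1 \<union> V2 \<union> ?W1 \<union> ?W2" if z: "z \<in> ?S" for z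
  proof -
    obtain c where c: "z - c *s a \<in> V2" using z D(3) by (rule span_insertE)
    consider "c = 0" | "c = 1" using scalar_cases[OF q] by blast
    then show ?thesis
    proof cases
      case 2
      then have "z - a \<in> span {f, g}" using c fg(1) by simp
      then obtain i j where "z - a = i *s f + j *s g" using mem_span_two by blast
      then have "z = a + (i *s f + j *s g)" by (simp add: algebra_simps)
      then show ?thesis using cov by metis
    qed (use c in simp)
  qed
  then have "?S \<subseteq> V1 \<union> V2 \<union> ?W1 \<union> ?W2" by blast
  moreover have "a \<notin> V2" using bisec_disjoint[OF V mem(1)] ab(3) span_zero by auto
  then have "CARD('f) ^ (2 * 2) < CARD('f) ^ 2 * card ?S" using card_span_insert[OF D(3)] D(9) q by simp
  ultimately show ?thesis using not_concurrently_complete_if_cover[OF d _ V W ne subspace_span] by simp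
qed

text \<open>Four subspaces of order 4 sharing 0 cover at most 13 of the 16 vectors, so some
  one-dimensional point misses them all. Thus for (q,k) = (2,2) the answer depends on
  \<open>m\<close>, which is why the theorem lists (2,2,1) separately.\<close>

lemma concurrently_complete_2_2_1:
  assumes q: "CARD('f) = 2" and d: "dim UNIV = 2 * 2"
  shows "concurrently_complete (subspace_bisection_geometry scale 1 2 0 0)"
proof (rule iffD2[OF concurrently_complete_00_iff[OF d]])
  show "\<forall>V1 V2 W1 W2. bisec 2 UNIV V1 V2 \<longrightarrow> bisec 2 UNIV W1 W2 \<longrightarrow> {V1, V2} \<noteq> {W1, W2} \<longrightarrow>
      (\<exists>U. subspace U \<and> dim U = 1 \<and> (\<forall>A\<in>{V1, V2, W1, W2}. U \<inter> A = {0}))"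
  proof (intro allI impI)
    fix V1 V2 W1 W2 assume V: "bisec 2 UNIV V1 V2" and W: "bisec 2 UNIV W1 W2"
    note D = bisecD[OF V] and E = bisecD[OF W]
    have "card V1 + card V2 + card W1 + card W2 < card (UNIV :: 'v set) + 3 * card {0 :: 'v}"
      using D(7-9) E(8,9) q by simp
    then obtain u where u: "u \<in> UNIV" "u \<notin> V1" "u \<notin> V2" "u \<notin> W1" "u \<notin> W2"
      by (rule not_union_four[where Z = "{0}"]) (use D(11,12,14,15) E(11,12,14,15) in simp_all)
    have u0: "u \<noteq> 0" using u(2) D(14) by auto
    have disj: "span {u} \<inter> A = {0}" if "subspace A" "u \<notin> A" for A
    proof -
      have "x = 0" if x: "x \<in> span {u}" "x \<in> A" for x
      proof -
        obtain c where c: "x = c *s u" using x(1) by (auto simp: span_singleton)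
        then have "c = 0" using mem_of_scale_mem[OF \<open>subspace A\<close>, of c u] x(2) \<open>u \<notin> A\<close> by blast
        then show ?thesis using c by simp
      qed
      then show ?thesis using subspace_0[OF \<open>subspace A\<close>] span_zero by blast
    qed
    have "dim (span {u}) = 1"
      using dim_span_eq_card_independent[of "{u}"] u0 by (simp add: independent_insert)
    then show "\<exists>U. subspace U \<and> dim U = 1 \<and> (\<forall>A\<in>{V1, V2, W1, W2}. U \<inter> A = {0})"
      using disj[OF D(2) u(2)] disj[OF D(3) u(3)] disj[OF E(2) u(4)] disj[OF E(3) u(5)]
      by (intro exI[of _ "span {u}"]) simp
  qed
qed simp

text \<open>Any \<open>m\<close>-dimensional subspace of a common complement is the desired point,
  as \<open>m \<le> k\<close>.\<close>

lemma concurrently_complete_00_if: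
  assumes d: "dim UNIV = 2 * k" "1 \<le> k" and m: "m \<le> k"
    and ne: "(CARD('f), k) \<notin> {(2, 1), (3, 1), (2, 2)}"
  shows "concurrently_complete (subspace_bisection_geometry scale m k 0 0)"
proof (rule iffD2[OF concurrently_complete_00_iff[OF d]], intro allI impI)
  have fin: "finite (UNIV :: 'v set)" using finite_UNIV_if_dim_pos d by simp
  fix V1 V2 W1 W2 assume V: "bisec k UNIV V1 V2" and W: "bisec k UNIV W1 W2"
  obtain U where U: "subspace U" "card U = CARD('f) ^ k" "\<forall>A\<in>{V1, V2, W1, W2}. U \<inter> A = {0}"
    using universally_common_complD[OF universally_common_compl_if[OF ne] V W]
    unfolding common_compl_def by blast
  have "dim U = k" using dim_eq_iff_card[OF fin U(1)] U(2) by blast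
  then obtain X where X: "subspace X" "X \<subseteq> U" "dim X = m"
    using exists_subspace_of_dim[OF fin U(1)] m by metis
  have "X \<inter> A = {0}" if "A \<in> {V1, V2, W1, W2}" for A
  proof -
    have "U \<inter> A = {0}" using U(3) that by blast
    then show ?thesis using X(2) subspace_0[OF X(1)] by blast
  qed
  then show "\<exists>U. subspace U \<and> dim U = m \<and> (\<forall>A\<in>{V1, V2, W1, W2}. U \<inter> A = {0})"
    using X(1,3) by blast
qed

end

theorem theorem1p3:
  fixes scale :: "'f::{field,finite} \<Rightarrow> 'v::ab_group_add \<Rightarrow> 'v"
    and k m :: nat
  assumes "vector_space scale"
    and "k \<ge> 1"
    and "vector_space.dim scale (UNIV :: 'v set) = 2 * k"
    and "m \<ge> 1"
    and "m \<le> k"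
  shows "(\<forall>k1 k2. k1 \<le> k2 \<longrightarrow> k1 + k2 \<le> m \<longrightarrow> real k2 > real m / 2 \<longrightarrow>
            (concurrently_complete (subspace_bisection_geometry scale m k k1 k2)
               \<longleftrightarrow> (CARD('f), k) = (2, 1)))
       \<and> (concurrently_complete (subspace_bisection_geometry scale m k 0 0)
            \<longleftrightarrow> (CARD('f), k) \<notin> {(2, 1), (3, 1), (2, 2)} \<or> (CARD('f), k, m) = (2, 2, 1))"
proof -
  interpret finite_field_space scale using assms(1) by (rule finite_field_space.intro)
  note d = assms(3,2)
  have "concurrently_complete (subspace_bisection_geometry scale m k k1 k2) \<longleftrightarrow> (CARD('f), k) = (2, 1)"
    if k12: "k1 \<le> k2" "k1 + k2 \<le> m" "real k2 > real m / 2" for k1 k2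
  proof (cases "(CARD('f), k) = (2, 1)")
    case True
    \<comment> \<open>From \<open>k = 1\<close> follows \<open>m = 1\<close>, and k2 > 1/2 together
      with k1 + k2 at most 1 leaves only the pair (0, 1).\<close>
    then have "k = 1" "m = 1" "k1 = 0" "k2 = 1" using k12 assms(4,5) by auto
    then show ?thesis using concurrently_complete_2_1 True assms(3) by simp
  next
    case False
    have "m < 2 * k2" using k12(3) by linarith
    then show ?thesis using not_concurrently_complete_if_large[OF d False] False by simp
  qed
  moreover have "concurrently_complete (subspace_bisection_geometry scale m k 0 0) \<longleftrightarrow>
      (CARD('f), k) \<notin> {(2, 1), (3, 1), (2, 2)} \<or> (CARD('f), k, m) = (2, 2, 1)"
  proof -
    consider "(CARD('f), k) \<notin> {(2, 1), (3, 1), (2, 2)}" | "CARD('f) = 2" "k = 1" | "CARD('f) = 3" "k = 1"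
      | "CARD('f) = 2" "k = 2" "m = 1" | "CARD('f) = 2" "k = 2" "m \<noteq> 1"
      by auto
    then show ?thesis
    proof cases
      case 1
      then show ?thesis using concurrently_complete_00_if[OF d assms(5)] by blast
    next
      case 2
      then have "m = 1" using assms(4,5) by simp
      then show ?thesis using not_concurrently_complete_2_1 2 assms(3) by simp
    next
      case 3
      then have "m = 1" using assms(4,5) by simp
      then show ?thesis using not_concurrently_complete_3_1 3 assms(3) by simp
    next
      case 4
      then show ?thesis using concurrently_complete_2_2_1 assms(3) by simp
    next
      case 5
      then have "m = 2" using assms(4,5) by simp
      then show ?thesis using not_concurrently_complete_2_2 5 assms(3) by simp
    qed
  qed
  ultimately show ?thesis by blast
qed

end
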